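(* Fix a real number $k>-1$ and positive integers $m,n$ with $\gcd(m,n)=1$. Then \[ \int_1^\infty \frac{\pi_k(t;m,n)-\pi(t^{k+1};m,n)}{t^{k+2}}\,dt \;=\; -\frac{\log(k+1)}{(k+1)\,\varphi(m)}, \] where the improper integral is understood as $\lim_{x\to\infty}\int_1^x$. In particular this value is negative when $k>0$ and positive when $-1<k<0$.
   Context: Throughout, $p$ denotes a prime. For real $x$ and real $k$, and coprime positive integers $m,n$, define $\pi(x;m,n)=\#\{p\le x : p\equiv n \pmod m\}$ and $\pi_k(x;m,n)=\sum_{p\le x,\ p\equiv n \pmod m} p^k$. $\varphi$ denotes Euler's totient function. *)

theory Defs
  imports "HOL-Analysis.Analysis" "HOL-Number_Theory.Number_Theory"
begin

definition prime_count_ap :: "real \<Rightarrow> nat \<Rightarrow> nat \<Rightarrow> real" where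
  "prime_count_ap x m n = real (card {p::nat. prime p \<and> real p \<le> x \<and> [p = n] (mod m)})"

definition prime_power_sum_ap :: "real \<Rightarrow> real \<Rightarrow> nat \<Rightarrow> nat \<Rightarrow> real" where
  "prime_power_sum_ap k x m n = (\<Sum>p\<in>{p::nat. prime p \<and> real p \<le> x \<and> [p = n] (mod m)}. real p powr k)"

end

theory Submission
  imports Defs "HOL-Computational_Algebra.Squarefree" "HOL-Real_Asymp.Real_Asymp"
begin

text \<open>
  Integrating term by term gives, up to terms that tend to \<open>0\<close>, that \<open>k + 1\<close> times the integral up to \<open>x\<close>
  is \<open>S x - S (x powr (k + 1))\<close>, where \<open>S x\<close> is the sum of \<open>1/p\<close> over the primes \<open>p \<le> x\<close> in the progression.
  So everything follows from \<open>S x = ln (ln x) / totient m + c + o(1)\<close>, which by partial summation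
  is a consequence of Mertens' theorem for progressions: the sum of \<open>ln p / p\<close> is
  \<open>ln x / totient m + O(1)\<close>. The latter is proved with Dirichlet characters and real methods only:
  the sum of \<open>\<psi> n \<Lambda> n / n\<close> is, for nonprincipal \<open>\<psi>\<close>, \<open>O(1)\<close> if \<open>L(1, \<psi>) \<noteq> 0\<close> and \<open>- ln x + O(1)\<close> otherwise. As the
  sum over \<open>n = 1 (mod m)\<close> is nonnegative, at most one \<open>L(1, \<psi>)\<close> vanishes; then \<open>\<psi>\<close> is real, and this
  case is excluded by Monsky's argument.
\<close>

section \<open>Dirichlet characters\<close>

text \<open>A bounded error in the sum of \<open>ln p / p\<close> is enough, because division by
  \<open>ln p\<close> turns it into a convergent series (Dirichlet's test). Hence
  \<open>S x - ln (ln x) / totient m\<close> has a limit, which cancels in the difference of the two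
  values of \<open>S\<close>; the answer comes from
  \<open>ln (ln (x powr (k + 1))) - ln (ln x) = ln (k + 1)\<close>. The terms that tend to
  \<open>0\<close> are the boundary terms of the integration. They vanish because the primes of the
  progression have density zero, and this is again read off from \<open>S\<close>: its part between
  \<open>e * x\<close> and \<open>x\<close> tends to \<open>0\<close>. The dichotomy for
  \<open>L(1, \<psi>)\<close> rests on two forms of one identity. That \<open>\<Lambda>\<close> sums
  over divisors to \<open>ln\<close> bounds the sum of \<open>\<psi> n \<Lambda> n / n\<close> after
  division by \<open>L(1, \<psi>)\<close>. When this value is \<open>0\<close> nothing can be
  divided, but then the Moebius inverse of the identity determines the growth.\<close>

definition partial_char :: "nat \<Rightarrow> nat set \<Rightarrow> (nat \<Rightarrow> complex) \<Rightarrow> bool" where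
  "partial_char m H \<psi> \<longleftrightarrow>
     (\<forall>a\<in>H. coprime a m) \<and> 1 \<in> H \<and> \<psi> 1 = 1 \<and>
     (\<forall>a\<in>H. \<forall>b\<in>H. a * b \<in> H \<and> \<psi> (a * b) = \<psi> a * \<psi> b) \<and>
     (\<forall>a\<in>H. \<forall>b. [a = b] (mod m) \<longrightarrow> b \<in> H \<and> \<psi> b = \<psi> a)"

definition dirichlet_chars :: "nat \<Rightarrow> (nat \<Rightarrow> complex) set" where
  "dirichlet_chars m = {\<psi>. (\<forall>a b. \<psi> (a * b) = \<psi> a * \<psi> b) \<and> (\<forall>a. \<psi> (a mod m) = \<psi> a) \<and>
     (\<forall>a. \<psi> a \<noteq> 0 \<longleftrightarrow> coprime a m)}"

definition principal_char :: "nat \<Rightarrow> nat \<Rightarrow> complex" where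
  "principal_char m a = (if coprime a m then 1 else 0)"

lemma partial_charD:
  assumes "partial_char m H \<psi>"
  shows "\<And>a. a \<in> H \<Longrightarrow> coprime a m" "1 \<in> H" "\<psi> 1 = 1" "\<And>a b. a \<in> H \<Longrightarrow> b \<in> H \<Longrightarrow> a * b \<in> H"
    "\<And>a b. a \<in> H \<Longrightarrow> b \<in> H \<Longrightarrow> \<psi> (a * b) = \<psi> a * \<psi> b"
  using assms unfolding partial_char_def by blast+

lemma partial_char_power:
  assumes "partial_char m H \<psi>" "a \<in> H"
  shows "a ^ j \<in> H \<and> \<psi> (a ^ j) = \<psi> a ^ j"
proof (induction j)
  case 0
  thus ?case using partial_charD[OF assms(1)] by simp
next
  case (Suc j)
  thus ?case using partial_charD[OF assms(1)] assms(2) by simp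
qed

lemma partial_char_cong:
  assumes "partial_char m H \<psi>" "a \<in> H" "[a = b] (mod m)"
  shows "b \<in> H" "\<psi> b = \<psi> a"
  using assms unfolding partial_char_def by blast+

text \<open>This exhibits the inverse of \<open>a\<close> modulo \<open>m\<close> as a power of
  \<open>a\<close>, so that closure under products yields closure under inverses.\<close>

lemma cong_power_pred_totient:
  fixes a m :: nat
  assumes "coprime a m" "m > 0"
  shows "[a * a ^ (totient m - 1) = 1] (mod m)"
proof -
  have "a * a ^ (totient m - 1) = a ^ totient m"
    using assms by (cases "totient m") auto
  thus ?thesis using euler_theorem[OF assms(1)] by simp
qed

text \<open>Seen modulo \<open>m\<close>, \<open>H\<close> is a subgroup of the finite group of
  units: \<open>h\<close> is cancelled by multiplying with its inverse, which is a power of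
  \<open>h\<close> and so lies in \<open>H\<close>.\<close>

lemma partial_char_cancel:
  assumes H: "partial_char m H \<psi>" and m: "m > 0" and "h \<in> H" "h * x \<in> H"
  shows "x \<in> H"
proof -
  let ?u = "h ^ (totient m - 1)"
  have cop: "coprime h m" using partial_charD(1)[OF H] assms by simp
  have "?u \<in> H" using partial_char_power[OF H \<open>h \<in> H\<close>] by blast
  hence "?u * (h * x) \<in> H" using partial_charD(4)[OF H] \<open>h * x \<in> H\<close> by blast
  moreover have "[h * ?u * x = 1 * x] (mod m)"
    by (intro cong_mult cong_refl cong_power_pred_totient cop m)
  hence "[?u * (h * x) = x] (mod m)" by (simp add: mult_ac)
  ultimately show ?thesis using partial_char_cong[OF H] by blast
qed

text \<open>Extension by one generator. \<open>r\<close> is the order of \<open>g\<close> relative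
  to \<open>H\<close>, so the new value \<open>w\<close> at \<open>g\<close> has to satisfy
  \<open>w ^ r = \<psi> (g ^ r)\<close>, and every such root works: put
  \<open>\<psi>' (h * g ^ j) = \<psi> h * w ^ j\<close>. Two representations of one residue differ
  by a power of \<open>g\<close> in \<open>H\<close>, whose exponent is a multiple of
  \<open>r\<close>. The new set again contains all representatives of its residue classes.\<close>

lemma partial_char_adjoin:
  assumes H: "partial_char m H \<psi>" and m: "m > 0" and g: "coprime g m"
    and r: "r > 0" "g ^ r \<in> H" "\<And>i. 0 < i \<Longrightarrow> i < r \<Longrightarrow> g ^ i \<notin> H" and w: "w ^ r = \<psi> (g ^ r)"
  obtains H' \<psi>' where "partial_char m H' \<psi>'" "H \<subseteq> H'" "g \<in> H'" "\<And>x. x \<in> H \<Longrightarrow> \<psi>' x = \<psi> x" "\<psi>' g = w"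
proof -
  \<comment> \<open>Division with remainder: \<open>g ^ (t mod r)\<close> would lie in
    \<open>H\<close> with an exponent below the minimal one.\<close>
  have rdvd: "r dvd t" if "g ^ t \<in> H" for t
  proof -
    have "g ^ t = (g ^ r) ^ (t div r) * g ^ (t mod r)"
      by (simp flip: power_mult power_add)
    hence "g ^ (t mod r) \<in> H"
      using partial_char_cancel[OF H m, of "(g ^ r) ^ (t div r)" "g ^ (t mod r)"] that
        partial_char_power[OF H r(2)] by auto
    hence "t mod r = 0" using r(3)[of "t mod r"] \<open>r > 0\<close> by (metis mod_less_divisor neq0_conv)
    thus ?thesis by auto
  qed
  \<comment> \<open>Ordering the exponents makes \<open>j - i\<close> a true difference; the other
    case is symmetric.\<close>
  have wd1: "\<psi> h * w ^ i = \<psi> h' * w ^ j"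
    if "h \<in> H" "h' \<in> H" "[h * g ^ i = h' * g ^ j] (mod m)" "i \<le> j" for h h' i j
  proof -
    have gj: "g ^ j = g ^ (j - i) * g ^ i" using that by (simp flip: power_add)
    have "[h * g ^ i = (h' * g ^ (j - i)) * g ^ i] (mod m)" using that gj by (simp add: mult_ac)
    hence c: "[h = h' * g ^ (j - i)] (mod m)"
      using cong_mult_rcancel_nat[of "g ^ i" m] g by simp
    have "h' * g ^ (j - i) \<in> H" using partial_char_cong[OF H \<open>h \<in> H\<close> c] by simp
    hence gin: "g ^ (j - i) \<in> H" using partial_char_cancel[OF H m \<open>h' \<in> H\<close>] by blast
    then obtain q where q: "j - i = r * q" using rdvd by blast
    have "\<psi> h = \<psi> (h' * g ^ (j - i))" using partial_char_cong[OF H \<open>h \<in> H\<close> c] by simp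
    also have "\<dots> = \<psi> h' * \<psi> ((g ^ r) ^ q)"
      using partial_charD(5)[OF H \<open>h' \<in> H\<close> gin] q by (simp add: power_mult)
    also have "\<dots> = \<psi> h' * w ^ (j - i)"
      using partial_char_power[OF H r(2)] w q by (simp add: power_mult)
    finally show ?thesis using \<open>i \<le> j\<close> by (simp flip: power_add)
  qed
  have wd: "\<psi> h * w ^ i = \<psi> h' * w ^ j"
    if "h \<in> H" "h' \<in> H" "[h * g ^ i = h' * g ^ j] (mod m)" for h h' i j
    using wd1[OF that] wd1[OF that(2,1) cong_sym[OF that(3)]] by (cases "i \<le> j") auto
  define H' where "H' = {x. \<exists>h\<in>H. \<exists>j. [x = h * g ^ j] (mod m)}"
  \<comment> \<open>The choice among representations is harmless by \<open>wd\<close>.\<close>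
  define \<psi>' where "\<psi>' x = (SOME z. \<exists>h\<in>H. \<exists>j. [x = h * g ^ j] (mod m) \<and> z = \<psi> h * w ^ j)" for x
  have \<psi>': "\<psi>' x = \<psi> h * w ^ j" if "h \<in> H" "[x = h * g ^ j] (mod m)" for x h j
  proof -
    have "\<exists>h\<in>H. \<exists>j. [x = h * g ^ j] (mod m) \<and> \<psi>' x = \<psi> h * w ^ j"
      unfolding \<psi>'_def
      by (rule someI_ex[where P = "\<lambda>z. \<exists>h\<in>H. \<exists>j. [x = h * g ^ j] (mod m) \<and> z = \<psi> h * w ^ j"])
        (rule exI[of _ "\<psi> h * w ^ j"], rule bexI[OF exI[of _ j] that(1)], use that in simp)
    then obtain h' j' where "h' \<in> H" "[x = h' * g ^ j'] (mod m)" "\<psi>' x = \<psi> h' * w ^ j'" by blast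
    thus ?thesis using wd[of h' h j' j] that by (metis cong_sym cong_trans)
  qed
  have copH: "coprime h m" if "h \<in> H" for h using partial_charD(1)[OF H] that .
  have sub: "x \<in> H' \<and> \<psi>' x = \<psi> x" if "x \<in> H" for x
    using that \<psi>'[of x x 0] by (auto simp: H'_def intro!: bexI[of _ x] exI[of _ 0])
  note one = partial_charD(2,3)[OF H]
  have gH': "g \<in> H' \<and> \<psi>' g = w"
    using one \<psi>'[of 1 g 1] by (auto simp: H'_def intro!: bexI[of _ 1] exI[of _ 1])
  have cop': "coprime a m" if a: "a \<in> H'" for a
  proof -
    obtain h j where "h \<in> H" "[a = h * g ^ j] (mod m)" using a unfolding H'_def by blast
    thus ?thesis using copH[of h] g cong_imp_coprime[of "h * g ^ j" a m] by (auto simp: cong_sym)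
  qed
  have mul: "a * b \<in> H' \<and> \<psi>' (a * b) = \<psi>' a * \<psi>' b" if ab: "a \<in> H'" "b \<in> H'" for a b
  proof -
    obtain h j h' j' where *: "h \<in> H" "[a = h * g ^ j] (mod m)" "h' \<in> H" "[b = h' * g ^ j'] (mod m)"
      using ab unfolding H'_def by blast
    have "[a * b = (h * g ^ j) * (h' * g ^ j')] (mod m)" by (intro cong_mult *)
    hence c: "[a * b = (h * h') * g ^ (j + j')] (mod m)" by (simp add: power_add mult_ac)
    have hh: "h * h' \<in> H" "\<psi> (h * h') = \<psi> h * \<psi> h'"
      using * partial_charD(4,5)[OF H] by simp_all
    show ?thesis
      using \<psi>'[OF hh(1) c] \<psi>'[OF *(1,2)] \<psi>'[OF *(3,4)]
      by (intro conjI) (use hh(1) c in \<open>unfold H'_def, blast\<close>, simp add: hh(2) power_add)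
  qed
  have cng: "b \<in> H' \<and> \<psi>' b = \<psi>' a" if a: "a \<in> H'" "[a = b] (mod m)" for a b
  proof -
    obtain h j where *: "h \<in> H" "[a = h * g ^ j] (mod m)" using a unfolding H'_def by blast
    have "[b = h * g ^ j] (mod m)" using * that by (meson cong_sym cong_trans)
    thus ?thesis using * \<psi>'[OF *] \<psi>'[of h b j] by (auto simp: H'_def)
  qed
  have "partial_char m H' \<psi>'"
    unfolding partial_char_def
  proof (intro conjI ballI allI impI)
    show "1 \<in> H'" "\<psi>' 1 = 1" using sub[OF one(1)] one(2) by simp_all
    show "coprime a m" if "a \<in> H'" for a using cop'[OF that] .
    show "a * b \<in> H'" "\<psi>' (a * b) = \<psi>' a * \<psi>' b" if "a \<in> H'" "b \<in> H'" for a b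
      using mul[OF that] by blast+
    show "b \<in> H'" "\<psi>' b = \<psi>' a" if "a \<in> H'" "[a = b] (mod m)" for a b
      using cng[OF that] by blast+
  qed
  with sub gH' show ?thesis by (intro that[of H' \<psi>']) auto
qed

lemma exists_power_mem_partial_char:
  assumes "partial_char m H \<psi>" "m > 0" "coprime g m"
  shows "\<exists>r>0. g ^ r \<in> H \<and> (\<forall>i. 0 < i \<longrightarrow> i < r \<longrightarrow> g ^ i \<notin> H)"
proof -
  have "1 \<in> H" using partial_charD(2)[OF assms(1)] .
  hence "g ^ totient m \<in> H"
    using partial_char_cong[OF assms(1), of 1 "g ^ totient m"] euler_theorem[OF assms(3)]
    by (auto simp: cong_sym)
  hence ex: "\<exists>r. r > 0 \<and> g ^ r \<in> H" using assms(2) by (intro exI[of _ "totient m"]) auto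
  define r where "r = (LEAST r. r > 0 \<and> g ^ r \<in> H)"
  have "r > 0 \<and> g ^ r \<in> H" unfolding r_def using LeastI_ex[OF ex] .
  moreover have "g ^ i \<notin> H" if "0 < i" "i < r" for i
    using not_less_Least[of i "\<lambda>r. r > 0 \<and> g ^ r \<in> H"] that unfolding r_def by blast
  ultimately show ?thesis by blast
qed

text \<open>Generators are adjoined until \<open>H\<close> contains every unit, which ends because
  the number of reduced residues outside \<open>H\<close> drops each time. The required roots exist
  since the values are complex. At the end the character is set to \<open>0\<close> on
  non-units.\<close>

lemma partial_char_extend:
  assumes "partial_char m H \<psi>" and m: "m > 0"
  shows "\<exists>\<theta>\<in>dirichlet_chars m. \<forall>x\<in>H. \<theta> x = \<psi> x"
  using assms(1)
proof (induction "card ({x\<in>{..<m}. coprime x m} - H)" arbitrary: H \<psi> rule: less_induct)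
  case less
  note H = less.prems
  show ?case
  proof (cases "\<exists>g. coprime g m \<and> g \<notin> H")
    case True
    then obtain g where g: "coprime g m" "g \<notin> H" by blast
    obtain r where r: "r > 0" "g ^ r \<in> H" "\<And>i. 0 < i \<Longrightarrow> i < r \<Longrightarrow> g ^ i \<notin> H"
      using exists_power_mem_partial_char[OF H m g(1)] by blast
    obtain w where w: "w ^ r = \<psi> (g ^ r)"
      using exists_complex_root[of r "\<psi> (g ^ r)"] r(1) by (metis neq0_conv)
    obtain H' \<psi>' where H': "partial_char m H' \<psi>'" "H \<subseteq> H'" "g \<in> H'" "\<And>x. x \<in> H \<Longrightarrow> \<psi>' x = \<psi> x"
      using partial_char_adjoin[OF H m g(1) r w] by metis
    have "g mod m \<in> H'" using partial_char_cong(1)[OF H'(1,3), of "g mod m"] by (simp add: cong_def)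
    moreover have "g mod m \<notin> H" using partial_char_cong(1)[OF H, of "g mod m" g] g by (auto simp: cong_def)
    moreover have "coprime (g mod m) m" "g mod m < m" using g m by simp_all
    ultimately have "{x\<in>{..<m}. coprime x m} - H' \<subset> {x\<in>{..<m}. coprime x m} - H"
      using H'(2) by blast
    hence "card ({x\<in>{..<m}. coprime x m} - H') < card ({x\<in>{..<m}. coprime x m} - H)"
      by (intro psubset_card_mono) auto
    then obtain \<theta> where "\<theta> \<in> dirichlet_chars m" "\<And>x. x \<in> H' \<Longrightarrow> \<theta> x = \<psi>' x"
      using less.hyps[OF _ H'(1)] by blast
    thus ?thesis using H'(2,4) by (metis subsetD)
  next
    case False
    hence HH: "x \<in> H \<longleftrightarrow> coprime x m" for x using partial_charD(1)[OF H] by blast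
    have "\<psi> x \<noteq> 0" if "x \<in> H" for x
    proof -
      have "[x ^ totient m = 1] (mod m)" using that HH euler_theorem by blast
      hence "\<psi> (x ^ totient m) = \<psi> 1"
        using partial_char_cong(2)[OF H partial_charD(2)[OF H], of "x ^ totient m"] cong_sym by blast
      hence "\<psi> x ^ totient m = 1" using partial_char_power[OF H that] partial_charD(3)[OF H] by simp
      thus ?thesis using m by (auto simp: power_0_left)
    qed
    moreover have "\<psi> (a mod m) = \<psi> a" if "a \<in> H" for a
      using partial_char_cong(2)[OF H that, of "a mod m"] by (simp add: cong_def)
    ultimately have "(\<lambda>x. if coprime x m then \<psi> x else 0) \<in> dirichlet_chars m"
      using m HH partial_charD(5)[OF H] by (auto simp: dirichlet_chars_def)
    thus ?thesis using HH by (intro bexI) auto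
  qed
qed

text \<open>Start from the trivial subgroup. There \<open>a\<close> has relative order
  \<open>r \<ge> 2\<close>, and it may be sent to the primitive root of unity
  \<open>cis (2 * pi / r)\<close>, which differs from \<open>1\<close>.\<close>

lemma dirichlet_char_separates:
  assumes m: "m > 0" and a: "coprime a m" "\<not> [a = 1] (mod m)"
  shows "\<exists>\<psi>\<in>dirichlet_chars m. \<psi> a \<noteq> 1"
proof -
  let ?H = "{x. [x = 1] (mod m)}"
  have H: "partial_char m ?H (\<lambda>_. 1)"
    unfolding partial_char_def
  proof (intro conjI ballI allI impI)
    show "coprime x m" if "x \<in> ?H" for x
      using that cong_imp_coprime[of 1 x m] by (auto simp: cong_sym_eq)
    show "x * y \<in> ?H" if "x \<in> ?H" "y \<in> ?H" for x y
      using that cong_mult[of x 1 m y 1] by simp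
    show "y \<in> ?H" if "x \<in> ?H" "[x = y] (mod m)" for x y
      using that by (simp add: cong_def)
  qed auto
  obtain r where r: "r > 0" "a ^ r \<in> ?H" "\<And>i. 0 < i \<Longrightarrow> i < r \<Longrightarrow> a ^ i \<notin> ?H"
    using exists_power_mem_partial_char[OF H m a(1)] by blast
  have "r \<noteq> 1" using r(2) a by auto
  hence "r \<ge> 2" using r(1) by simp
  define w where "w = cis (2 * pi / real r)"
  have "real r * (2 * pi / real r) = 2 * pi" using r(1) by simp
  hence w: "w ^ r = 1" unfolding w_def Complex.DeMoivre by (simp only: cis_2pi)
  have "w \<noteq> 1"
  proof
    assume "w = 1"
    hence "cos (2 * pi / real r) = 1" by (simp add: w_def complex_eq_iff)
    then obtain i :: int where "2 * pi / real r = real_of_int i * 2 * pi" using cos_one_2pi_int by blast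
    hence "1 = real_of_int i * real r" using \<open>r \<ge> 2\<close> by (simp add: field_simps)
    hence "1 = i * int r" by (metis of_int_1 of_int_eq_iff of_int_mult of_int_of_nat_eq)
    hence "int r dvd 1" by (metis dvd_triv_right)
    thus False using \<open>r \<ge> 2\<close> by simp
  qed
  obtain H' \<psi>' where H': "partial_char m H' \<psi>'" "a \<in> H'" "\<psi>' a = w"
    using partial_char_adjoin[OF H m a(1) r] w by metis
  thus ?thesis using partial_char_extend[OF H'(1) m] \<open>w \<noteq> 1\<close> by metis
qed

section \<open>Basic properties of the characters modulo m\<close>

lemma dirichlet_char_mult: "\<psi> \<in> dirichlet_chars m \<Longrightarrow> \<psi> (a * b) = \<psi> a * \<psi> b"
  and dirichlet_char_mod: "\<psi> \<in> dirichlet_chars m \<Longrightarrow> \<psi> (a mod m) = \<psi> a"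
  and dirichlet_char_eq_0_iff: "\<psi> \<in> dirichlet_chars m \<Longrightarrow> \<psi> a = 0 \<longleftrightarrow> \<not> coprime a m"
  by (auto simp: dirichlet_chars_def)

lemma dirichlet_char_cong:
  assumes "\<psi> \<in> dirichlet_chars m" "[a = b] (mod m)"
  shows "\<psi> a = \<psi> b"
  using assms dirichlet_char_mod[OF assms(1), of a] dirichlet_char_mod[OF assms(1), of b]
  by (simp add: cong_def)

lemma dirichlet_char_1:
  assumes "\<psi> \<in> dirichlet_chars m"
  shows "\<psi> 1 = 1"
  using dirichlet_char_mult[OF assms, of 1 1] dirichlet_char_eq_0_iff[OF assms, of 1] by simp

lemma dirichlet_char_power:
  assumes "\<psi> \<in> dirichlet_chars m"
  shows "\<psi> (a ^ j) = \<psi> a ^ j"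
  using dirichlet_char_1[OF assms] by (induction j) (simp_all add: dirichlet_char_mult[OF assms])

lemma dirichlet_char_root_of_unity:
  assumes "\<psi> \<in> dirichlet_chars m" "coprime a m"
  shows "\<psi> a ^ totient m = 1"
  using dirichlet_char_cong[OF assms(1) euler_theorem[OF assms(2)]]
  by (simp add: dirichlet_char_power[OF assms(1)] dirichlet_char_1[OF assms(1), simplified])

lemma norm_dirichlet_char:
  assumes "\<psi> \<in> dirichlet_chars m" "m > 0" "coprime a m"
  shows "norm (\<psi> a) = 1"
proof -
  have "norm (\<psi> a) = 1 \<or> totient m = 0"
    using dirichlet_char_root_of_unity[OF assms(1,3)] by (rule power_eq_1_iff)
  thus ?thesis using assms(2) by (metis totient_0_iff less_numeral_extra(3))
qed

lemma norm_dirichlet_char_le: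
  assumes "\<psi> \<in> dirichlet_chars m" "m > 0"
  shows "norm (\<psi> a) \<le> 1"
  using norm_dirichlet_char[OF assms, of a] dirichlet_char_eq_0_iff[OF assms(1), of a]
  by (cases "coprime a m") auto

lemma dirichlet_chars_mult:
  "\<psi> \<in> dirichlet_chars m \<Longrightarrow> \<theta> \<in> dirichlet_chars m \<Longrightarrow> (\<lambda>a. \<psi> a * \<theta> a) \<in> dirichlet_chars m"
  by (auto simp: dirichlet_chars_def)

lemma dirichlet_chars_cnj: "\<psi> \<in> dirichlet_chars m \<Longrightarrow> (\<lambda>a. cnj (\<psi> a)) \<in> dirichlet_chars m"
  by (auto simp: dirichlet_chars_def)

lemma principal_char_in: "m > 0 \<Longrightarrow> principal_char m \<in> dirichlet_chars m"
  by (auto simp: dirichlet_chars_def principal_char_def)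

lemma dirichlet_char_cnj_mult:
  assumes "\<psi> \<in> dirichlet_chars m" "m > 0"
  shows "cnj (\<psi> a) * \<psi> a = principal_char m a"
  using norm_dirichlet_char[OF assms, of a] dirichlet_char_eq_0_iff[OF assms(1), of a]
    complex_norm_square[of "\<psi> a"]
  by (cases "coprime a m") (auto simp: principal_char_def mult.commute)

text \<open>A character is determined by its values below \<open>m\<close>, and each of these is
  \<open>0\<close> or a root of unity of order dividing \<open>totient m\<close>.\<close>

lemma finite_dirichlet_chars:
  assumes "m > 0"
  shows "finite (dirichlet_chars m)"
proof (rule inj_on_finite)
  let ?R = "insert 0 {z::complex. z ^ totient m = 1}"
  show "inj_on (\<lambda>\<psi>. restrict \<psi> {..<m}) (dirichlet_chars m)"
  proof (rule inj_onI, rule ext)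
    fix \<psi> \<theta> a assume *: "\<psi> \<in> dirichlet_chars m" "\<theta> \<in> dirichlet_chars m"
      "restrict \<psi> {..<m} = restrict \<theta> {..<m}"
    have "\<psi> (a mod m) = \<theta> (a mod m)" using fun_cong[OF *(3), of "a mod m"] assms by simp
    thus "\<psi> a = \<theta> a" using * by (simp add: dirichlet_char_mod)
  qed
  show "(\<lambda>\<psi>. restrict \<psi> {..<m}) ` dirichlet_chars m \<subseteq> (\<Pi>\<^sub>E a\<in>{..<m}. ?R)"
  proof (intro image_subsetI PiE_I)
    fix \<psi> a assume \<psi>: "\<psi> \<in> dirichlet_chars m" and "a \<in> {..<m}"
    thus "restrict \<psi> {..<m} a \<in> ?R"
      using dirichlet_char_root_of_unity[OF \<psi>, of a] dirichlet_char_eq_0_iff[OF \<psi>, of a] by auto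
  qed auto
  have "finite {z::complex. z ^ totient m = 1}" using assms by (intro finite_roots_unity) (simp_all add: Suc_le_eq)
  thus "finite (\<Pi>\<^sub>E a\<in>{..<m}. ?R)" by (intro finite_PiE) auto
qed

section \<open>Orthogonality relations\<close>

text \<open>The representatives are those that \<open>mod m\<close> returns. This differs from
  \<open>totatives m\<close> only for \<open>m = 1\<close>, where the class is represented by
  \<open>0\<close> instead of \<open>1\<close>.\<close>

definition reduced_residues :: "nat \<Rightarrow> nat set" where
  "reduced_residues m = {a\<in>{..<m}. coprime a m}"

lemma finite_reduced_residues [simp]: "finite (reduced_residues m)"
  by (simp add: reduced_residues_def)

lemma card_reduced_residues:
  assumes "m > 0"
  shows "card (reduced_residues m) = totient m"
proof (cases "m = 1")
  case False
  hence "reduced_residues m = totatives m"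
    using assms by (auto simp: reduced_residues_def totatives_def order_le_less intro!: Nat.gr0I)
  thus ?thesis by (simp add: totient_def)
qed (auto simp: reduced_residues_def)

lemma bij_betw_mult_reduced_residues:
  assumes m: "m > 0" and b: "coprime b m"
  shows "bij_betw (\<lambda>a. (a * b) mod m) (reduced_residues m) (reduced_residues m)"
proof -
  have inj: "inj_on (\<lambda>a. (a * b) mod m) (reduced_residues m)"
  proof (rule inj_onI)
    fix x y assume *: "x \<in> reduced_residues m" "y \<in> reduced_residues m" "(x * b) mod m = (y * b) mod m"
    hence "[x * b = y * b] (mod m)" by (simp add: cong_def)
    hence "[x = y] (mod m)" using cong_mult_rcancel_nat[of b m] b by blast
    thus "x = y" using * by (simp add: reduced_residues_def cong_def)
  qed
  have sub: "(\<lambda>a. (a * b) mod m) ` reduced_residues m \<subseteq> reduced_residues m"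
    using m b by (auto simp: reduced_residues_def)
  show ?thesis using inj endo_inj_surj[OF _ sub inj] by (simp add: bij_betw_def)
qed

text \<open>Multiplication by a unit \<open>b\<close> with \<open>\<psi> b \<noteq> 1\<close>
  permutes the residues and multiplies the sum by \<open>\<psi> b\<close>.\<close>

lemma sum_dirichlet_char_residues:
  assumes \<psi>: "\<psi> \<in> dirichlet_chars m" "\<psi> \<noteq> principal_char m" and m: "m > 0"
  shows "(\<Sum>a\<in>reduced_residues m. \<psi> a) = 0"
proof -
  obtain b where b: "\<psi> b \<noteq> principal_char m b" using \<psi>(2) by blast
  hence cop: "coprime b m" "\<psi> b \<noteq> 1"
    using dirichlet_char_eq_0_iff[OF \<psi>(1), of b] by (auto simp: principal_char_def split: if_splits)
  have "(\<Sum>a\<in>reduced_residues m. \<psi> a) = (\<Sum>a\<in>reduced_residues m. \<psi> ((a * b) mod m))"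
    using sum.reindex_bij_betw[OF bij_betw_mult_reduced_residues[OF m cop(1)], of \<psi>] by simp
  also have "\<dots> = (\<Sum>a\<in>reduced_residues m. \<psi> a) * \<psi> b"
    by (simp add: dirichlet_char_mod[OF \<psi>(1)] dirichlet_char_mult[OF \<psi>(1)] sum_distrib_right)
  finally show ?thesis using cop(2) by simp
qed

lemma sum_dirichlet_char_period:
  assumes \<psi>: "\<psi> \<in> dirichlet_chars m" "\<psi> \<noteq> principal_char m" and m: "m > 0"
  shows "(\<Sum>a<m. \<psi> a) = 0"
proof -
  have "(\<Sum>a<m. \<psi> a) = (\<Sum>a\<in>reduced_residues m. \<psi> a)"
    using dirichlet_char_eq_0_iff[OF \<psi>(1)]
    by (intro sum.mono_neutral_right) (auto simp: reduced_residues_def)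
  thus ?thesis using sum_dirichlet_char_residues[OF assms] by simp
qed

text \<open>Complete periods contribute \<open>0\<close>; fewer than \<open>m\<close> terms of norm
  at most \<open>1\<close> remain.\<close>

lemma norm_sum_dirichlet_char_le:
  assumes \<psi>: "\<psi> \<in> dirichlet_chars m" "\<psi> \<noteq> principal_char m" and m: "m > 0"
  shows "norm (\<Sum>a<N. \<psi> a) \<le> real m"
proof (induction N rule: less_induct)
  case (less N)
  show ?case
  proof (cases "N < m")
    case True
    have "norm (\<Sum>a<N. \<psi> a) \<le> (\<Sum>a<N. 1)"
      by (intro sum_norm_le norm_dirichlet_char_le[OF \<psi>(1) m])
    thus ?thesis using True by simp
  next
    case False
    have "(\<Sum>a<m + (N - m). \<psi> a) = (\<Sum>a<m. \<psi> a) + (\<Sum>a<N - m. \<psi> (a + m))"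
      unfolding lessThan_atLeast0 by (subst sum.atLeastLessThan_concat[of 0 m "m + (N - m)", symmetric])
        (auto simp: sum.shift_bounds_nat_ivl[of \<psi> 0 m "N - m", symmetric] add.commute)
    also have "(\<Sum>a<N - m. \<psi> (a + m)) = (\<Sum>a<N - m. \<psi> a)"
      by (intro sum.cong refl dirichlet_char_cong[OF \<psi>(1)]) (simp add: cong_def)
    finally have "(\<Sum>a<N. \<psi> a) = (\<Sum>a<N - m. \<psi> a)"
      using False sum_dirichlet_char_period[OF assms] by simp
    thus ?thesis using less.IH[of "N - m"] False m by simp
  qed
qed

text \<open>The dual argument: multiplication by a character \<open>\<theta>\<close> with
  \<open>\<theta> a \<noteq> 1\<close> permutes the characters, with inverse multiplication by
  \<open>cnj \<theta>\<close>.\<close>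

lemma sum_dirichlet_chars_eq_0:
  assumes m: "m > 0" and a: "coprime a m" "\<not> [a = 1] (mod m)"
  shows "(\<Sum>\<psi>\<in>dirichlet_chars m. \<psi> a) = 0"
proof -
  obtain \<theta> where \<theta>: "\<theta> \<in> dirichlet_chars m" "\<theta> a \<noteq> 1" using dirichlet_char_separates[OF assms] by blast
  have inv: "cnj (\<theta> x) * (\<theta> x * \<psi> x) = \<psi> x" "\<theta> x * (cnj (\<theta> x) * \<psi> x) = \<psi> x"
    if "\<psi> \<in> dirichlet_chars m" for \<psi> x
    using dirichlet_char_cnj_mult[OF \<theta>(1) m, of x] dirichlet_char_eq_0_iff[OF that, of x]
    by (auto simp: principal_char_def mult_ac split: if_splits)
  have "(\<Sum>\<psi>\<in>dirichlet_chars m. \<psi> a) = (\<Sum>\<psi>\<in>dirichlet_chars m. \<theta> a * \<psi> a)"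
    using \<theta>(1) inv
    by (intro sum.reindex_bij_witness[of _ "\<lambda>\<psi> x. \<theta> x * \<psi> x" "\<lambda>\<psi> x. cnj (\<theta> x) * \<psi> x"])
      (auto intro: dirichlet_chars_mult dirichlet_chars_cnj)
  hence "(\<Sum>\<psi>\<in>dirichlet_chars m. \<psi> a) = \<theta> a * (\<Sum>\<psi>\<in>dirichlet_chars m. \<psi> a)"
    by (rule trans[OF _ sum_distrib_left[symmetric]])
  thus ?thesis using \<theta>(2) by simp
qed

text \<open>Double counting of \<open>\<psi> a\<close> over residues and characters: one order
  leaves only the class of \<open>1\<close>, the other only the principal character.\<close>

lemma card_dirichlet_chars:
  assumes m: "m > 0"
  shows "card (dirichlet_chars m) = totient m"
proof -
  \<comment> \<open>The class of \<open>1\<close> has the representative \<open>1 mod m\<close>,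
    which is \<open>0\<close> when \<open>m = 1\<close>.\<close>
  have 1: "(\<Sum>a\<in>reduced_residues m. \<Sum>\<psi>\<in>dirichlet_chars m. \<psi> a) = (\<Sum>a\<in>{1 mod m}. of_nat (card (dirichlet_chars m)))"
  proof (intro sum.mono_neutral_cong_right ballI)
    show "{1 mod m} \<subseteq> reduced_residues m" using m by (simp add: reduced_residues_def)
    show "(\<Sum>\<psi>\<in>dirichlet_chars m. \<psi> a) = 0" if "a \<in> reduced_residues m - {1 mod m}" for a
      using that by (intro sum_dirichlet_chars_eq_0[OF m]) (auto simp: reduced_residues_def cong_def)
    show "(\<Sum>\<psi>\<in>dirichlet_chars m. \<psi> a) = of_nat (card (dirichlet_chars m))" if "a \<in> {1 mod m}" for a
    proof -
      have "\<psi> a = 1" if "\<psi> \<in> dirichlet_chars m" for \<psi>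
        using \<open>a \<in> {1 mod m}\<close> dirichlet_char_mod[OF that, of 1] dirichlet_char_1[OF that] by simp
      hence "(\<Sum>\<psi>\<in>dirichlet_chars m. \<psi> a) = (\<Sum>\<psi>\<in>dirichlet_chars m. 1)" by (intro sum.cong refl)
      thus ?thesis by simp
    qed
  qed auto
  have "(\<Sum>\<psi>\<in>dirichlet_chars m. \<Sum>a\<in>reduced_residues m. \<psi> a) = (\<Sum>\<psi>\<in>{principal_char m}. of_nat (totient m))"
  proof (intro sum.mono_neutral_cong_right ballI finite_dirichlet_chars[OF m])
    show "(\<Sum>a\<in>reduced_residues m. \<psi> a) = of_nat (totient m)" if "\<psi> \<in> {principal_char m}" for \<psi>
      using that card_reduced_residues[OF m] by (simp add: principal_char_def reduced_residues_def)
  qed (use sum_dirichlet_char_residues m principal_char_in in auto)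
  with 1 have "(of_nat (card (dirichlet_chars m)) :: complex) = of_nat (totient m)"
    by (subst (asm) sum.swap) simp
  thus ?thesis by (simp only: of_nat_eq_iff)
qed

text \<open>Since \<open>cnj (\<psi> n)\<close> is the value at the inverse \<open>u\<close> of
  \<open>n\<close>, the sum is that of \<open>\<psi> (u * a)\<close>, and \<open>u * a\<close> is
  \<open>1\<close> modulo \<open>m\<close> precisely for \<open>a\<close> in the class of
  \<open>n\<close>.\<close>

lemma dirichlet_char_orthogonality:
  assumes m: "m > 0" and n: "coprime n m"
  shows "(\<Sum>\<psi>\<in>dirichlet_chars m. cnj (\<psi> n) * \<psi> a) = (if [a = n] (mod m) then of_nat (totient m) else 0)"
proof (cases "coprime a m")
  case False
  hence "\<not> [a = n] (mod m)" using n cong_imp_coprime cong_sym by blast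
  moreover have "\<psi> a = 0" if "\<psi> \<in> dirichlet_chars m" for \<psi>
    using dirichlet_char_eq_0_iff[OF that] False by simp
  ultimately show ?thesis by (simp add: sum.neutral)
next
  case True
  define u where "u = n ^ (totient m - 1)"
  have u: "[n * u = 1] (mod m)" unfolding u_def by (rule cong_power_pred_totient[OF n m])
  have eq: "cnj (\<psi> n) * \<psi> a = \<psi> (u * a)" if "\<psi> \<in> dirichlet_chars m" for \<psi>
  proof -
    have "\<psi> n * \<psi> u = 1"
      using dirichlet_char_cong[OF that u] dirichlet_char_1[OF that] dirichlet_char_mult[OF that] by simp
    moreover have "cnj (\<psi> n) * \<psi> n = 1"
      using dirichlet_char_cnj_mult[OF that m, of n] n by (simp add: principal_char_def)
    ultimately have "cnj (\<psi> n) = \<psi> u" by (metis mult.assoc mult.left_neutral mult.right_neutral)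
    thus ?thesis using dirichlet_char_mult[OF that] by simp
  qed
  have iff: "[u * a = 1] (mod m) \<longleftrightarrow> [a = n] (mod m)"
  proof
    assume "[u * a = 1] (mod m)"
    hence "[n * (u * a) = n * 1] (mod m)" by (intro cong_mult cong_refl)
    moreover have "[(n * u) * a = 1 * a] (mod m)" by (intro cong_mult cong_refl u)
    ultimately show "[a = n] (mod m)" by (simp add: mult.assoc) (metis cong_sym cong_trans)
  next
    assume "[a = n] (mod m)"
    hence "[u * a = u * n] (mod m)" by (intro cong_mult cong_refl)
    thus "[u * a = 1] (mod m)" using u by (metis cong_trans mult.commute)
  qed
  have cop: "coprime (u * a) m" using True n by (simp add: u_def)
  have "(\<Sum>\<psi>\<in>dirichlet_chars m. cnj (\<psi> n) * \<psi> a) = (\<Sum>\<psi>\<in>dirichlet_chars m. \<psi> (u * a))"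
    by (intro sum.cong refl eq)
  also have "\<dots> = (if [a = n] (mod m) then of_nat (totient m) else 0)"
  proof (cases "[a = n] (mod m)")
    case True
    hence "\<psi> (u * a) = 1" if "\<psi> \<in> dirichlet_chars m" for \<psi>
      using iff dirichlet_char_cong[OF that] dirichlet_char_1[OF that] by metis
    hence "(\<Sum>\<psi>\<in>dirichlet_chars m. \<psi> (u * a)) = (\<Sum>\<psi>\<in>dirichlet_chars m. 1)" by (intro sum.cong refl)
    thus ?thesis using True card_dirichlet_chars[OF m] by simp
  qed (use iff sum_dirichlet_chars_eq_0[OF m cop] in auto)
  finally show ?thesis .
qed

section \<open>Elementary estimates\<close>

lemma sum_by_parts_ivl:
  fixes f :: "nat \<Rightarrow> 'a::real_normed_vector" and g :: "nat \<Rightarrow> real"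
  assumes "a \<le> b"
  shows "(\<Sum>i\<in>{a..<b}. g i *\<^sub>R f i) =
           g b *\<^sub>R (\<Sum>i\<in>{a..<b}. f i) + (\<Sum>i\<in>{a..<b}. (g i - g (Suc i)) *\<^sub>R (\<Sum>j\<in>{a..<Suc i}. f j))"
  using assms
proof (induction b rule: dec_induct)
  case (step b)
  thus ?case by (simp add: algebra_simps)
qed auto

text \<open>After summation by parts the differences of \<open>g\<close> are nonnegative and
  telescope, so all of them together cost no more than \<open>B * g a\<close>.\<close>

lemma norm_sum_antimono_le:
  fixes f :: "nat \<Rightarrow> 'a::real_normed_vector" and g :: "nat \<Rightarrow> real"
  assumes bd: "\<And>n. norm (\<Sum>i\<in>{a..<n}. f i) \<le> B"
    and dec: "\<And>i. i \<ge> a \<Longrightarrow> g (Suc i) \<le> g i" and nn: "\<And>i. i \<ge> a \<Longrightarrow> 0 \<le> g i"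
  shows "norm (\<Sum>i\<in>{a..<b}. g i *\<^sub>R f i) \<le> B * g a"
proof -
  have B: "B \<ge> 0" using bd[of a] by simp
  show ?thesis
  proof (cases "a \<le> b")
    case True
    have "norm (\<Sum>i\<in>{a..<b}. g i *\<^sub>R f i) \<le> norm (g b *\<^sub>R (\<Sum>i\<in>{a..<b}. f i)) +
        norm (\<Sum>i\<in>{a..<b}. (g i - g (Suc i)) *\<^sub>R (\<Sum>j\<in>{a..<Suc i}. f j))"
      by (subst sum_by_parts_ivl[OF True]) (rule norm_triangle_ineq)
    also have "norm (g b *\<^sub>R (\<Sum>i\<in>{a..<b}. f i)) \<le> g b * B"
      using nn[OF True] bd[of b] by (simp add: mult_left_mono)
    also have "norm (\<Sum>i\<in>{a..<b}. (g i - g (Suc i)) *\<^sub>R (\<Sum>j\<in>{a..<Suc i}. f j))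
        \<le> (\<Sum>i\<in>{a..<b}. (g i - g (Suc i)) * B)"
    proof (rule sum_norm_le)
      fix i assume "i \<in> {a..<b}"
      thus "norm ((g i - g (Suc i)) *\<^sub>R (\<Sum>j\<in>{a..<Suc i}. f j)) \<le> (g i - g (Suc i)) * B"
        using dec[of i] bd[of "Suc i"] by (simp add: mult_left_mono del: sum.op_ivl_Suc)
    qed
    also have "(\<Sum>i\<in>{a..<b}. (g i - g (Suc i)) * B) = (g a - g b) * B"
      using sum_Suc_diff'[OF True, of "\<lambda>i. - g i"] by (simp flip: sum_distrib_right)
    finally show ?thesis by (simp add: algebra_simps)
  qed (use B nn in auto)
qed

text \<open>The factor \<open>2\<close> arises because a sum over an interval is a difference of two
  initial sums. Monotonicity is required only from \<open>a\<close> on: \<open>1 / n\<close> has the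
  value \<open>0\<close> at \<open>0\<close>, and \<open>ln n / n\<close> decreases only from
  \<open>3\<close>.\<close>

lemma
  fixes f :: "nat \<Rightarrow> 'a::banach" and g :: "nat \<Rightarrow> real"
  assumes bd: "\<And>n. norm (\<Sum>i<n. f i) \<le> B"
    and dec: "\<And>i. i \<ge> a \<Longrightarrow> g (Suc i) \<le> g i" and lim: "g \<longlonglongrightarrow> 0"
  shows Dirichlet_test_summable: "summable (\<lambda>i. g i *\<^sub>R f i)"
    and Dirichlet_test_tail: "N \<ge> a \<Longrightarrow> norm ((\<Sum>i. g i *\<^sub>R f i) - (\<Sum>i<N. g i *\<^sub>R f i)) \<le> 2 * B * g N"
proof -
  have nn: "0 \<le> g i" if "i \<ge> a" for i
  proof (rule LIMSEQ_le_const2[OF lim])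
    have "g j \<le> g i" if "j \<ge> i" for j
      using that by (induction j rule: dec_induct) (use dec \<open>i \<ge> a\<close> in \<open>auto intro: order_trans\<close>)
    thus "\<exists>N. \<forall>n\<ge>N. g n \<le> g i" by blast
  qed
  have bd': "norm (\<Sum>i\<in>{N..<n}. f i) \<le> 2 * B" for N n
  proof (cases "N \<le> n")
    case True
    have "(\<Sum>i\<in>{N..<n}. f i) = (\<Sum>i<n. f i) - (\<Sum>i<N. f i)"
      using True sum.atLeastLessThan_concat[of 0 N n f] by (simp add: lessThan_atLeast0 algebra_simps)
    thus ?thesis using norm_triangle_ineq4[of "\<Sum>i<n. f i" "\<Sum>i<N. f i"] bd[of n] bd[of N] by simp
  qed (use bd[of 0] in auto)
  have ivl: "norm (\<Sum>i\<in>{N..<M}. g i *\<^sub>R f i) \<le> 2 * B * g N" if "N \<ge> a" for N M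
    by (rule norm_sum_antimono_le) (use that bd' dec nn in auto)
  show sm: "summable (\<lambda>i. g i *\<^sub>R f i)"
    unfolding summable_Cauchy
  proof (intro allI impI)
    fix e :: real assume "e > 0"
    have "(\<lambda>N. 2 * B * g N) \<longlonglongrightarrow> 2 * B * 0" by (intro tendsto_intros lim)
    hence "eventually (\<lambda>N. 2 * B * g N < e \<and> N \<ge> a) sequentially"
      using \<open>e > 0\<close> by (intro eventually_conj eventually_ge_at_top order_tendstoD(2)[of _ 0]) auto
    then obtain N where N: "\<And>n. n \<ge> N \<Longrightarrow> 2 * B * g n < e \<and> n \<ge> a"
      by (auto simp: eventually_sequentially)
    show "\<exists>N. \<forall>m\<ge>N. \<forall>n. norm (\<Sum>i\<in>{m..<n}. g i *\<^sub>R f i) < e"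
      using N ivl by (intro exI[of _ N]) (meson le_less_trans)
  qed
  show "norm ((\<Sum>i. g i *\<^sub>R f i) - (\<Sum>i<N. g i *\<^sub>R f i)) \<le> 2 * B * g N" if "N \<ge> a"
  proof (rule LIMSEQ_le_const2)
    show "(\<lambda>M. norm ((\<Sum>i<M. g i *\<^sub>R f i) - (\<Sum>i<N. g i *\<^sub>R f i)))
        \<longlonglongrightarrow> norm ((\<Sum>i. g i *\<^sub>R f i) - (\<Sum>i<N. g i *\<^sub>R f i))"
      by (intro tendsto_intros summable_LIMSEQ sm)
    have "norm ((\<Sum>i<M. g i *\<^sub>R f i) - (\<Sum>i<N. g i *\<^sub>R f i)) \<le> 2 * B * g N" if "M \<ge> N" for M
    proof -
      have "(\<Sum>i<M. g i *\<^sub>R f i) - (\<Sum>i<N. g i *\<^sub>R f i) = (\<Sum>i\<in>{N..<M}. g i *\<^sub>R f i)"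
        using that sum.atLeastLessThan_concat[of 0 N M "\<lambda>i. g i *\<^sub>R f i"]
        by (simp add: lessThan_atLeast0 algebra_simps)
      thus ?thesis using ivl[OF \<open>N \<ge> a\<close>, of M] by simp
    qed
    thus "\<exists>M0. \<forall>M\<ge>M0. norm ((\<Sum>i<M. g i *\<^sub>R f i) - (\<Sum>i<N. g i *\<^sub>R f i)) \<le> 2 * B * g N"
      by blast
  qed
qed

section \<open>Bounds of Chebyshev and Mertens for the von Mangoldt function\<close>

lemma sum_divisors_swap:
  fixes f :: "nat \<Rightarrow> nat \<Rightarrow> 'a::comm_monoid_add"
  shows "(\<Sum>n=1..N. \<Sum>d | d dvd n. f d (n div d)) = (\<Sum>d=1..N. \<Sum>e=1..N div d. f d e)"
proof -
  have "(\<Sum>n=1..N. \<Sum>d | d dvd n. f d (n div d)) = (\<Sum>(n,d)\<in>(SIGMA n:{1..N}. {d. d dvd n}). f d (n div d))"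
    by (rule sum.Sigma) auto
  also have "\<dots> = (\<Sum>(d,e)\<in>(SIGMA d:{1..N}. {1..N div d}). f d e)"
    by (rule sum.reindex_bij_witness[of _ "\<lambda>(d,e). (d * e, d)" "\<lambda>(n,d). (d, n div d)"])
      (auto simp: div_le_mono less_eq_div_iff_mult_less_eq mult.commute Suc_le_eq
        intro!: Nat.gr0I intro: order_trans[OF dvd_imp_le] dest: dvd_imp_le)
  also have "\<dots> = (\<Sum>d=1..N. \<Sum>e=1..N div d. f d e)"
    by (rule sum.Sigma[symmetric]) auto
  finally show ?thesis .
qed

lemma ln_fact_eq_sum_mangoldt: "ln (fact N) = (\<Sum>d=1..N. mangoldt d * real (N div d))"
proof -
  have "ln (fact N :: real) = (\<Sum>n=1..N. ln (real n))"
    unfolding fact_prod of_nat_prod by (subst ln_prod) auto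
  also have "\<dots> = (\<Sum>n=1..N. \<Sum>d | d dvd n. mangoldt d)"
    by (intro sum.cong refl) (simp add: mangoldt_sum)
  also have "\<dots> = (\<Sum>d=1..N. mangoldt d * real (N div d))"
    by (subst sum_divisors_swap) (simp add: mult.commute)
  finally show ?thesis .
qed

lemma ln_fact_ge: "real N * ln (real N) - real N \<le> ln (fact N)"
proof (induction N)
  case (Suc N)
  show ?case
  proof (cases "N = 0")
    case False
    have "ln (1 + 1 / real N) \<le> 1 / real N" by (rule ln_add_one_self_le_self) auto
    moreover have "1 + 1 / real N = real (Suc N) / real N" using False by (simp add: field_simps)
    ultimately have "ln (real (Suc N)) \<le> ln (real N) + 1 / real N"
      using False by (simp add: ln_div)
    hence "real N * ln (real (Suc N)) \<le> real N * (ln (real N) + 1 / real N)" by (intro mult_left_mono) auto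
    also have "\<dots> = real N * ln (real N) + 1" using False by (simp add: field_simps)
    finally have "real N * ln (real (Suc N)) \<le> real N * ln (real N) + 1" .
    moreover have "ln (fact (Suc N) :: real) = ln (real (Suc N)) + ln (fact N)"
      unfolding fact_Suc by (subst ln_mult) auto
    moreover have "real (Suc N) * ln (real (Suc N)) = real N * ln (real (Suc N)) + ln (real (Suc N))"
      by (simp add: algebra_simps)
    ultimately show ?thesis using Suc by simp
  qed auto
qed auto

lemma ln_fact_le: "ln (fact N) \<le> real N * ln (real N)"
proof (cases "N = 0")
  case False
  have "ln (fact N) \<le> ln (real N ^ N)"
    using False fact_le_power[of N, where ?'a = real] by (subst ln_le_cancel_iff) auto
  thus ?thesis using False by (simp add: ln_realpow)
qed auto

text \<open>The binomial coefficient of \<open>N\<close> over \<open>N div 2\<close> is at most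
  \<open>2 ^ N\<close>. The second factor \<open>2 ^ N\<close> is a crude bound for the extra
  \<open>N div 2 + 1\<close> that appears when \<open>N\<close> is odd.\<close>

lemma fact_le_half_squared: "fact N \<le> 4 ^ N * (fact (N div 2) :: nat)\<^sup>2"
proof -
  let ?k = "N div 2"
  have "fact (N - ?k) \<le> (fact ?k * (?k + 1) :: nat)"
  proof (cases "even N")
    case True
    hence "N - ?k = ?k" by presburger
    thus ?thesis by simp
  next
    case False
    hence "N - ?k = Suc ?k" by presburger
    thus ?thesis by (simp add: algebra_simps)
  qed
  also have "?k + 1 \<le> 2 ^ N"
    by (rule order_trans[OF _ Suc_leI[OF less_exp]]) auto
  finally have 1: "fact (N - ?k) \<le> (fact ?k * 2 ^ N :: nat)" by simp
  have "fact N = fact ?k * fact (N - ?k) * (N choose ?k)"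
    using binomial_fact_lemma[of ?k N] by simp
  also have "\<dots> \<le> fact ?k * (fact ?k * 2 ^ N) * 2 ^ N"
    by (intro mult_le_mono 1 binomial_le_pow2 order_refl)
  also have "\<dots> = 4 ^ N * (fact ?k)\<^sup>2"
    using power_mult_distrib[of "2::nat" 2 N] by (simp add: power2_eq_square)
  finally show ?thesis .
qed

text \<open>The sum over \<open>N div 2 < n \<le> N\<close> is at most
  \<open>ln (fact N) - 2 * ln (fact (N div 2))\<close>, hence at most \<open>ln 4 * N\<close>.
  Repeated halving doubles the constant.\<close>

lemma Chebyshev_bound: "(\<Sum>n=1..N. mangoldt n) \<le> 2 * ln 4 * real N"
proof (induction N rule: less_induct)
  case (less N)
  show ?case
  proof (cases "N = 0")
    case False
    let ?k = "N div 2"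
    have "(\<Sum>n=1..N. mangoldt n) - (\<Sum>n=1..?k. mangoldt n) = (\<Sum>n\<in>{?k<..N}. mangoldt n :: real)"
    proof -
      have "{1..N} = {1..?k} \<union> {?k<..N}" by auto
      moreover have "sum mangoldt ({1..?k} \<union> {?k<..N}) = sum mangoldt {1..?k} + (sum mangoldt {?k<..N} :: real)"
        by (rule sum.union_disjoint) auto
      ultimately show ?thesis by simp
    qed
    also have "\<dots> \<le> (\<Sum>d=1..N. mangoldt d * (real (N div d) - 2 * real (?k div d)))"
    proof -
      \<comment> \<open>The weight of \<open>d\<close> is the parity bit of \<open>N div d\<close>:
        always \<open>0\<close> or \<open>1\<close>, and equal to \<open>1\<close> for
        \<open>d\<close> above \<open>N div 2\<close>, where the quotient is
        \<open>1\<close>.\<close>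
      have *: "real (N div d) - 2 * real (?k div d) = real ((N div d) mod 2)" for d
      proof -
        have "?k div d = (N div d) div 2" by (simp add: div_mult2_eq[symmetric] mult.commute)
        thus ?thesis using div_mult_mod_eq[of "N div d" 2]
          by (metis add_diff_cancel_left' mult.commute of_nat_add of_nat_mult of_nat_numeral)
      qed
      have "N div d = 1" if "d \<in> {?k<..N}" for d
        using that by (intro div_nat_eqI) auto
      hence "(\<Sum>n\<in>{?k<..N}. mangoldt n :: real) = (\<Sum>d\<in>{?k<..N}. mangoldt d * real ((N div d) mod 2))"
        by simp
      also have "\<dots> \<le> (\<Sum>d=1..N. mangoldt d * real ((N div d) mod 2))"
        by (intro sum_mono2) (auto intro!: mult_nonneg_nonneg mangoldt_nonneg)
      finally show ?thesis by (simp only: *)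
    qed
    also have "\<dots> = ln (fact N) - 2 * ln (fact ?k)"
    proof -
      have "(\<Sum>d=1..?k. mangoldt d * real (?k div d)) = (\<Sum>d=1..N. mangoldt d * real (?k div d))"
        by (intro sum.mono_neutral_left) auto
      thus ?thesis
        by (simp add: ln_fact_eq_sum_mangoldt sum_subtractf sum_distrib_left algebra_simps)
    qed
    also have "\<dots> \<le> ln 4 * real N"
    proof -
      have "real (fact N) \<le> real (4 ^ N * (fact ?k)\<^sup>2)"
        using fact_le_half_squared[of N] by (simp only: of_nat_le_iff)
      hence "(fact N :: real) \<le> 4 ^ N * (fact ?k)\<^sup>2" by simp
      hence "ln (fact N :: real) \<le> ln (4 ^ N * (fact ?k)\<^sup>2)" by (subst ln_le_cancel_iff) auto
      thus ?thesis by (simp add: ln_mult ln_realpow mult.commute)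
    qed
    finally have "(\<Sum>n=1..N. mangoldt n) \<le> (\<Sum>n=1..?k. mangoldt n) + ln 4 * real N" by simp
    also have "(\<Sum>n=1..?k. mangoldt n) \<le> 2 * ln 4 * real ?k" using False by (intro less) auto
    also have "2 * ln 4 * real ?k \<le> ln 4 * real N"
    proof -
      have "2 * real ?k \<le> real N" by linarith
      from mult_left_mono[OF this, of "ln 4"] show ?thesis by simp
    qed
    finally show ?thesis by (simp add: mult_ac)
  qed auto
qed

text \<open>\<open>ln (fact N)\<close> is the same sum with \<open>N / d\<close> rounded down. The
  rounding costs at most the sum of \<open>mangoldt d\<close>, which is linear in \<open>N\<close>
  by Chebyshev.\<close>

lemma Mertens_mangoldt:
  assumes "N > 0"
  shows "\<bar>(\<Sum>d=1..N. mangoldt d / real d) - ln (real N)\<bar> \<le> 2 * ln 4"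
proof -
  \<comment> \<open>Needed to absorb the error \<open>N\<close> of the lower bound for
    \<open>ln (fact N)\<close> into the constant \<open>2 * ln 4\<close>.\<close>
  have ln4: "ln (4::real) \<ge> 1"
    using ln_ge_iff[of 4 1] exp_le by simp
  have d: "(\<Sum>d=1..N. mangoldt d * (real N / real d)) - ln (fact N)
      = (\<Sum>d=1..N. mangoldt d * (real N / real d - real (N div d)))"
    by (simp add: ln_fact_eq_sum_mangoldt sum_subtractf algebra_simps)
  have frac: "0 \<le> real N / real d - real (N div d)" "real N / real d - real (N div d) \<le> 1" for d

  proof -
    have "real N = real d * real (N div d) + real (N mod d)" by (simp flip: of_nat_mult of_nat_add)
    moreover have "real (N mod d) \<le> real d" if "d > 0" using that by (simp add: order_less_imp_le)
    ultimately show "real N / real d - real (N div d) \<le> 1"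
      by (cases "d = 0") (simp_all add: field_simps)
  qed (simp add: of_nat_div_le_of_nat)
  have 1: "0 \<le> (\<Sum>d=1..N. mangoldt d * (real N / real d - real (N div d)))"
    by (intro sum_nonneg mult_nonneg_nonneg mangoldt_nonneg frac)
  have "(\<Sum>d=1..N. mangoldt d * (real N / real d - real (N div d))) \<le> (\<Sum>d=1..N. mangoldt d * 1)"
    by (intro sum_mono mult_left_mono mangoldt_nonneg frac)
  also have "\<dots> \<le> 2 * ln 4 * real N" using Chebyshev_bound[of N] by simp
  finally have 2: "(\<Sum>d=1..N. mangoldt d * (real N / real d - real (N div d))) \<le> 2 * ln 4 * real N" .
  have e: "(\<Sum>d=1..N. mangoldt d * (real N / real d)) = real N * (\<Sum>d=1..N. mangoldt d / real d)"
    by (simp add: sum_distrib_left algebra_simps)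
  have "\<bar>real N * (\<Sum>d=1..N. mangoldt d / real d) - real N * ln (real N)\<bar> \<le> 2 * ln 4 * real N"
    using 1 2 d e ln_fact_ge[of N] ln_fact_le[of N] mult_right_mono[OF ln4, of "real N"] by (simp add: abs_le_iff)
  hence "real N * \<bar>(\<Sum>d=1..N. mangoldt d / real d) - ln (real N)\<bar> \<le> real N * (2 * ln 4)"
    by (simp add: abs_mult right_diff_distrib[symmetric] mult.commute)
  thus ?thesis using assms by simp
qed

section \<open>Moebius inversion\<close>

definition moebius_mu :: "nat \<Rightarrow> real" where
  "moebius_mu n = (if squarefree n then (-1) ^ card (prime_factors n) else 0)"

lemma abs_moebius_mu_le: "\<bar>moebius_mu n\<bar> \<le> 1"
  by (simp add: moebius_mu_def power_abs)

lemma moebius_mu_prime_mult: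
  assumes p: "prime p" "\<not> p dvd d" and "squarefree d"
  shows "moebius_mu (p * d) = - moebius_mu d"
proof -
  have cop: "coprime p d" using p by (simp add: prime_imp_coprime)
  have d0: "d \<noteq> 0" using assms(3) by (metis not_squarefree_0)
  have sq: "squarefree (p * d)"
    using squarefree_mult_coprime[OF cop] squarefree_prime[OF p(1)] assms(3) by blast
  have "prime_factors (p * d) = insert p (prime_factors d)"
    using p d0 by (simp add: prime_factors_product prime_prime_factors)
  moreover have "p \<notin> prime_factors d" using p by auto
  ultimately have "card (prime_factors (p * d)) = Suc (card (prime_factors d))" by simp
  thus ?thesis using sq assms(3) by (simp add: moebius_mu_def)
qed

text \<open>For a prime \<open>p\<close> dividing \<open>n\<close>, the squarefree divisors prime to
  \<open>p\<close> pair off with their multiples by \<open>p\<close>, with opposite signs.\<close>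

lemma sum_moebius_mu_divisors:
  assumes "n > 0"
  shows "(\<Sum>d | d dvd n. moebius_mu d) = (if n = 1 then 1 else 0)"
proof (cases "n = 1")
  case True
  thus ?thesis by (simp add: moebius_mu_def)
next
  case False
  then obtain p where p: "prime p" "p dvd n" using prime_factor_nat by blast
  have fin: "finite {d. d dvd n}" using assms by simp
  define A where "A = {d. d dvd n \<and> squarefree d \<and> \<not> p dvd d}"
  define B where "B = {d. d dvd n \<and> squarefree d \<and> p dvd d}"
  have finAB: "finite A" "finite B" using fin by (auto simp: A_def B_def intro: finite_subset)
  have "(\<Sum>d | d dvd n. moebius_mu d) = (\<Sum>d\<in>A \<union> B. moebius_mu d)"
    using fin by (intro sum.mono_neutral_right) (auto simp: A_def B_def moebius_mu_def)
  also have "\<dots> = (\<Sum>d\<in>A. moebius_mu d) + (\<Sum>d\<in>B. moebius_mu d)"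
    using finAB by (intro sum.union_disjoint) (auto simp: A_def B_def)
  also have "(\<Sum>d\<in>B. moebius_mu d) = (\<Sum>d\<in>A. moebius_mu (p * d))"
  proof (rule sum.reindex_bij_witness[of _ "\<lambda>d. p * d" "\<lambda>d. d div p"])
    fix d assume d: "d \<in> B"
    then obtain e where e: "d = p * e" by (auto simp: B_def)
    have sq: "squarefree (p * e)" using d e by (simp add: B_def)
    have "\<not> p dvd e"
    proof
      assume "p dvd e"
      hence "p\<^sup>2 dvd p * e" by (auto simp: power2_eq_square)
      thus False using squarefreeD[OF sq] p(1) by (simp add: not_prime_unit)
    qed
    thus "d div p \<in> A" "p * (d div p) = d" "moebius_mu (p * (d div p)) = moebius_mu d"
      using d e p(1) sq by (auto simp: A_def B_def intro: dvd_mult_right squarefree_multD(2))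
  next
    fix d assume d: "d \<in> A"
    hence "coprime p d" using p by (simp add: A_def prime_imp_coprime)
    moreover from this have "squarefree (p * d)"
      using squarefree_mult_coprime[OF _ squarefree_prime[OF p(1)], of d] d by (simp add: A_def)
    ultimately show "p * d \<in> B" using d p by (simp add: A_def B_def divides_mult)
    show "p * d div p = d" using p(1) by auto
  qed
  also have "\<dots> = - (\<Sum>d\<in>A. moebius_mu d)"
    unfolding sum_negf[symmetric] using p(1) by (intro sum.cong) (auto simp: A_def moebius_mu_prime_mult)
  finally show ?thesis using False by simp
qed

text \<open>Moebius inversion of \<open>mangoldt_sum\<close>: expand the logarithm and exchange the
  two divisors, so that the inner Moebius sum leaves only \<open>e = n\<close>.\<close>

lemma mangoldt_eq_sum_moebius_mu:
  assumes n: "n > 0"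
  shows "(\<Sum>d | d dvd n. moebius_mu d * ln (real (n div d))) = mangoldt n"
proof -
  have dvd_divD: "b dvd n" "a dvd n div b" if "a dvd n" "b dvd n div a" for a b
  proof -
    obtain e where "n div a = b * e" using \<open>b dvd n div a\<close> by (rule dvdE)
    hence "n = a * (b * e)" using \<open>a dvd n\<close> by (metis dvd_mult_div_cancel)
    moreover from this have "a > 0" "b > 0" using n by auto
    ultimately     show "b dvd n" "a dvd n div b" by (auto simp: mult.left_commute[of a b])
  qed
  have fin: "finite {d. d dvd k}" if "k dvd n" for k
    using that n by (intro finite_divisors_nat) (auto intro: Nat.gr0I)
  have "(\<Sum>d | d dvd n. moebius_mu d * ln (real (n div d)))
      = (\<Sum>d | d dvd n. \<Sum>e | e dvd n div d. moebius_mu d * mangoldt e)"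
  proof (intro sum.cong refl)
    fix d assume "d \<in> {d. d dvd n}"
    hence "n div d \<noteq> 0" using n by (auto simp: dvd_div_eq_0_iff)
    from mangoldt_sum[OF this, where ?'a = real]
    show "moebius_mu d * ln (real (n div d)) = (\<Sum>e | e dvd n div d. moebius_mu d * mangoldt e)"
      by (simp add: sum_distrib_left[symmetric])
  qed
  also have "\<dots> = (\<Sum>(d,e)\<in>(SIGMA d:{d. d dvd n}. {e. e dvd n div d}). moebius_mu d * mangoldt e)"
    using n by (intro sum.Sigma ballI fin) (auto intro: div_dvd_div)
  also have "\<dots> = (\<Sum>(e,d)\<in>(SIGMA e:{e. e dvd n}. {d. d dvd n div e}). moebius_mu d * mangoldt e)"
  proof (rule sum.reindex_bij_witness[of _ prod.swap prod.swap])
    fix x assume "x \<in> (SIGMA d:{d. d dvd n}. {e. e dvd n div d})"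
    thus "prod.swap x \<in> (SIGMA e:{e. e dvd n}. {d. d dvd n div e})"
      using dvd_divD[of "fst x" "snd x"] by (cases x) simp
  next
    fix x assume "x \<in> (SIGMA e:{e. e dvd n}. {d. d dvd n div e})"
    thus "prod.swap x \<in> (SIGMA d:{d. d dvd n}. {e. e dvd n div d})"
      using dvd_divD[of "fst x" "snd x"] by (cases x) simp
  qed (simp_all add: case_prod_unfold)
  also have "\<dots> = (\<Sum>e | e dvd n. \<Sum>d | d dvd n div e. moebius_mu d * mangoldt e)"
    using n by (intro sum.Sigma[symmetric] ballI fin) (auto intro: div_dvd_div)
  also have "\<dots> = (\<Sum>e | e dvd n. if e = n then mangoldt n else 0)"
  proof (intro sum.cong refl)
    fix e assume e: "e \<in> {e. e dvd n}"
    hence "n div e > 0" using n by (auto intro!: Nat.gr0I simp: dvd_div_eq_0_iff)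
    moreover have "n div e = 1 \<longleftrightarrow> e = n"
      using e n by (metis div_self dvd_mult_div_cancel mem_Collect_eq mult.right_neutral neq0_conv)
    ultimately show "(\<Sum>d | d dvd n div e. moebius_mu d * mangoldt e) = (if e = n then mangoldt n else 0)"
      by (simp add: sum_distrib_right[symmetric] sum_moebius_mu_divisors)
  qed
  also have "\<dots> = mangoldt n" using n by simp
  finally show ?thesis .
qed

text \<open>Writing \<open>ln (N / d)\<close> as \<open>(ln N - ln n) + ln (n div d)\<close>, the
  first part survives only at \<open>n = 1\<close>. This isolated \<open>ln N\<close> becomes the
  main term when \<open>L_one \<psi> = 0\<close>.\<close>

lemma sum_moebius_mu_ln:
  assumes "n > 0" "N > 0"
  shows "(\<Sum>d | d dvd n. moebius_mu d * ln (real N / real d)) = (if n = 1 then ln (real N) else 0) + mangoldt n"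
proof -
  have "(\<Sum>d | d dvd n. moebius_mu d * ln (real N / real d))
      = (\<Sum>d | d dvd n. moebius_mu d * (ln (real N) - ln (real n)) + moebius_mu d * ln (real (n div d)))"
  proof (intro sum.cong refl)
    fix d assume "d \<in> {d. d dvd n}"
    then obtain e where e: "n = d * e" by auto
    hence "d > 0" "e > 0" using assms by auto
    thus "moebius_mu d * ln (real N / real d)
        = moebius_mu d * (ln (real N) - ln (real n)) + moebius_mu d * ln (real (n div d))"
      using assms e by (simp add: ln_div ln_mult algebra_simps)
  qed
  also have "\<dots> = (if n = 1 then ln (real N) else 0) + mangoldt n"
    using assms by (simp add: sum.distrib sum_distrib_right[symmetric] sum_moebius_mu_divisors
      mangoldt_eq_sum_moebius_mu)
  finally show ?thesis .
qed

text \<open>Only proper prime powers contribute, and \<open>ln p / p ^ j\<close> summed over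
  \<open>j \<ge> 2\<close> is of the size of \<open>ln p / p\<^sup>2\<close>, which is
  summable.\<close>

lemma sum_nonprime_mangoldt_bounded:
  "\<exists>C. \<forall>N. (\<Sum>n | n \<in> {1..N} \<and> \<not> prime n. mangoldt n / real n) \<le> C"
proof -
  \<comment> \<open>The geometric series gives at most \<open>2 / p ^ 2\<close>, and
    \<open>ln p\<close> is at most \<open>2 * p powr (1/2)\<close>; the product is
    \<open>g p\<close>.\<close>
  define g where "g p = 4 * real p powr (-3/2)" for p :: nat
  have g: "summable g"
    unfolding g_def by (intro summable_mult) (simp add: summable_real_powr_iff)
  have inner: "(\<Sum>j=2..N. ln (real p) / real p ^ j) \<le> g p" if "p \<ge> 2" for p N
  proof -
    have p: "real p \<ge> 2" using that by simp
    have "(\<Sum>j=2..N. (1 / real p) ^ j) \<le> 2 / (real p)\<^sup>2"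
    proof -
      have "(\<Sum>j=2..N. (1 / real p) ^ j) \<le> (\<Sum>j\<in>{2..<2+N}. (1 / real p) ^ j)"
        by (intro sum_mono2) auto
      also have "\<dots> = (1 / real p)\<^sup>2 * (\<Sum>j<N. (1 / real p) ^ j)"
        by (subst sum.shift_bounds_nat_ivl[of _ 0 2 N, simplified add_0 add.commute[of N]])
          (simp add: sum_distrib_left power_add lessThan_atLeast0 mult.commute power2_eq_square)
      also have "(\<Sum>j<N. (1 / real p) ^ j) \<le> (\<Sum>j. (1 / real p) ^ j)"
        using p by (intro sum_le_suminf summable_geometric) auto
      also have "\<dots> = 1 / (1 - 1 / real p)" using p by (intro suminf_geometric) auto
      also have "\<dots> \<le> 2" using p by (simp add: field_simps)
      finally show ?thesis by (simp add: power_divide divide_right_mono)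
    qed
    hence "ln (real p) * (\<Sum>j=2..N. (1 / real p) ^ j) \<le> ln (real p) * (2 / (real p)\<^sup>2)"
      using p by (intro mult_left_mono) auto
    also have "\<dots> \<le> (real p powr (1/2) / (1/2)) * (2 / (real p)\<^sup>2)"
      using p by (intro mult_right_mono ln_powr_bound) auto
    also have "\<dots> = 4 * (real p powr (1/2) / real p powr 2)"
      using p by simp
    also have "\<dots> = g p" unfolding g_def powr_diff[symmetric] by simp
    finally show ?thesis by (simp add: sum_distrib_left power_divide)
  qed
  have "(\<Sum>n | n \<in> {1..N} \<and> \<not> prime n. mangoldt n / real n) \<le> suminf g" for N
  proof -
    define S where "S = {n. n \<in> {1..N} \<and> \<not> prime n \<and> primepow n}"
    \<comment> \<open>Splits a prime power into base and exponent. Injectivity lets the sum be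
      enlarged to a rectangle of pairs.\<close>
    define h where "h n = (aprimedivisor n, multiplicity (aprimedivisor n) n)" for n :: nat
    have dec: "prime (fst (h n))" "snd (h n) > 0" "fst (h n) ^ snd (h n) = n" if "primepow n" for n
      using that primepow_decompose[OF that] prime_aprimedivisor'[of n] primepow_gt_Suc_0[OF that]
      by (auto simp: h_def primepow_def aprimedivisor_prime_power)
    have inj: "inj_on h S" by (rule inj_onI) (metis S_def dec(3) mem_Collect_eq)
    have "(\<Sum>n | n \<in> {1..N} \<and> \<not> prime n. mangoldt n / real n) = (\<Sum>n\<in>S. mangoldt n / real n)"
      by (intro sum.mono_neutral_right) (auto simp: S_def mangoldt_def)
    also have "\<dots> = (\<Sum>n\<in>S. (\<lambda>(p,j). ln (real p) / real p ^ j) (h n))"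
    proof (intro sum.cong refl)
      fix n assume "n \<in> S"
      hence n: "primepow n" by (simp add: S_def)
      show "mangoldt n / real n = (\<lambda>(p,j). ln (real p) / real p ^ j) (h n)"
        using dec[OF n] mangoldt_primepow'[of "fst (h n)" "snd (h n)", where ?'a = real]
        by (simp add: case_prod_unfold flip: of_nat_power)
    qed
    also have "\<dots> = (\<Sum>(p,j)\<in>h ` S. ln (real p) / real p ^ j)"
      using inj by (simp add: sum.reindex)
    also have "\<dots> \<le> (\<Sum>(p,j)\<in>{2..N}\<times>{2..N}. ln (real p) / real p ^ j)"
    proof (intro sum_mono2)
      show "h ` S \<subseteq> {2..N} \<times> {2..N}"
      proof (intro image_subsetI)
        fix n assume n: "n \<in> S"
        define p j where "p = fst (h n)" "j = snd (h n)"
        have pj: "prime p" "j > 0" "p ^ j = n" using dec n by (simp_all add: p_j_def S_def)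
        have p2: "p \<ge> 2" using pj by (simp add: prime_ge_2_nat)
        have "j \<noteq> 1" using pj n by (auto simp: S_def)
        hence "j \<ge> 2" using pj by simp
        moreover have "p ^ 1 \<le> p ^ j" using p2 pj by (intro power_increasing) auto
        moreover have "j < p ^ j" using p2 by (intro power_gt_expt) auto
        ultimately have "(p, j) \<in> {2..N} \<times> {2..N}" using p2 pj n by (auto simp: S_def)
        thus "h n \<in> {2..N} \<times> {2..N}" by (simp add: p_j_def)
      qed
    qed (auto intro!: divide_nonneg_nonneg)
    also have "\<dots> = (\<Sum>p=2..N. \<Sum>j=2..N. ln (real p) / real p ^ j)" by (simp add: sum.cartesian_product)
    also have "\<dots> \<le> (\<Sum>p=2..N. g p)" by (intro sum_mono inner) auto
    also have "\<dots> \<le> suminf g" by (intro sum_le_suminf g) (auto simp: g_def)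
    finally show ?thesis .
  qed
  thus ?thesis by blast
qed

section \<open>The values \<open>L(1, \<psi>)\<close>\<close>

text \<open>The term \<open>n = 0\<close> vanishes because \<open>1 / 0 = 0\<close>. The value is
  meaningful for nonprincipal characters, where the series converges by Dirichlet's test.\<close>

definition L_one :: "(nat \<Rightarrow> complex) \<Rightarrow> complex" where
  "L_one \<psi> = (\<Sum>n. (1 / real n) *\<^sub>R \<psi> n)"

lemma L_one_tail:
  assumes \<psi>: "\<psi> \<in> dirichlet_chars m" "\<psi> \<noteq> principal_char m" and m: "m > 0"
  shows "norm (L_one \<psi> - (\<Sum>n=1..N. (1 / real n) *\<^sub>R \<psi> n)) \<le> 2 * real m / real (Suc N)"
proof -
  have dec: "1 / real (Suc i) \<le> 1 / real i" if "i \<ge> 1" for i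
    using that by (simp add: field_simps)
  have lim: "(\<lambda>n. 1 / real n) \<longlonglongrightarrow> 0" by (rule lim_1_over_n)
  have "(\<Sum>n<Suc N. (1 / real n) *\<^sub>R \<psi> n) = (\<Sum>n=1..N. (1 / real n) *\<^sub>R \<psi> n)"
    by (intro sum.mono_neutral_right) auto
  thus ?thesis
    using Dirichlet_test_tail[where f = \<psi> and a = 1 and N = "Suc N", OF norm_sum_dirichlet_char_le[OF assms] dec lim]
    by (simp add: L_one_def del: sum.lessThan_Suc)
qed

lemma ln_over_n_antimono:
  assumes "n \<ge> 3"
  shows "ln (real (Suc n)) / real (Suc n) \<le> ln (real n) / real n"
proof -
  have "ln (real n) \<ge> 1"
    using assms exp_le by (subst ln_ge_iff) auto
  have "ln (1 + 1 / real n) \<le> 1 / real n" by (rule ln_add_one_self_le_self) auto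
  moreover have "1 + 1 / real n = real (Suc n) / real n" using assms by (simp add: field_simps)
  ultimately have "ln (real (Suc n)) \<le> ln (real n) + 1 / real n"
    using assms by (simp add: ln_div)
  hence "real n * ln (real (Suc n)) \<le> real n * (ln (real n) + 1 / real n)" by (intro mult_left_mono) auto
  also have "\<dots> = real n * ln (real n) + 1" using assms by (simp add: field_simps)
  also have "\<dots> \<le> real (Suc n) * ln (real n)" using \<open>ln (real n) \<ge> 1\<close> by (simp add: algebra_simps)
  finally show ?thesis using assms by (simp add: field_simps)
qed

lemma sum_dirichlet_char_ln_bounded:
  assumes \<psi>: "\<psi> \<in> dirichlet_chars m" "\<psi> \<noteq> principal_char m" and m: "m > 0"
  shows "\<exists>C. \<forall>N. norm (\<Sum>n=1..N. (ln (real n) / real n) *\<^sub>R \<psi> n) \<le> C"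
proof -
  have "summable (\<lambda>n. (ln (real n) / real n) *\<^sub>R \<psi> n)"
    by (rule Dirichlet_test_summable[where a = 3 and B = "real m"])
      (use norm_sum_dirichlet_char_le[OF assms] ln_over_n_antimono lim_ln_over_n in auto)
  hence "convergent (\<lambda>N. \<Sum>n<N. (ln (real n) / real n) *\<^sub>R \<psi> n)"
    by (simp add: summable_iff_convergent)
  then obtain C where C: "\<And>N. norm (\<Sum>n<N. (ln (real n) / real n) *\<^sub>R \<psi> n) \<le> C"
    by (metis convergent_imp_Bseq Bseq_def)
  have "(\<Sum>n=1..N. (ln (real n) / real n) *\<^sub>R \<psi> n) = (\<Sum>n<Suc N. (ln (real n) / real n) *\<^sub>R \<psi> n)" for N
    by (intro sum.mono_neutral_left) auto
  thus ?thesis using C by (metis (no_types))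
qed

text \<open>Converts the tail of the series cut at \<open>N div d\<close> into \<open>d / N\<close>,
  whose numerator cancels the weight \<open>1 / d\<close>.\<close>

lemma inverse_Suc_div_le:
  assumes "d > 0" "N > 0"
  shows "1 / real (Suc (N div d)) \<le> real d / real N"
proof -
  have "N < d * Suc (N div d)" using assms(1) by (simp add: dividend_less_times_div)
  hence "real N \<le> real (d * Suc (N div d))" by (simp only: of_nat_le_iff)
  hence "real N \<le> real d * real (Suc (N div d))" by (simp only: of_nat_mult)
  thus ?thesis using assms by (simp add: field_simps)
qed

definition char_mangoldt_sum :: "(nat \<Rightarrow> complex) \<Rightarrow> nat \<Rightarrow> complex" where
  "char_mangoldt_sum \<psi> N = (\<Sum>n=1..N. (mangoldt n / real n) *\<^sub>R \<psi> n)"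

text \<open>Expanding \<open>ln n\<close> over divisors gives the bounded sum of
  \<open>\<psi> n * ln n / n\<close> as a sum over \<open>d\<close> of
  \<open>\<psi> d * mangoldt d / d\<close> times the partial sum of the series at
  \<open>N div d\<close>. Replacing each partial sum by \<open>L_one \<psi>\<close> costs O(1) by
  Chebyshev, and then one divides by \<open>L_one \<psi>\<close>.\<close>

lemma char_mangoldt_sum_bounded:
  assumes \<psi>: "\<psi> \<in> dirichlet_chars m" "\<psi> \<noteq> principal_char m" and m: "m > 0" and L: "L_one \<psi> \<noteq> 0"
  shows "\<exists>C. \<forall>N>0. norm (char_mangoldt_sum \<psi> N) \<le> C"
proof -
  obtain C where C: "\<And>N. norm (\<Sum>n=1..N. (ln (real n) / real n) *\<^sub>R \<psi> n) \<le> C"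
    using sum_dirichlet_char_ln_bounded[OF assms(1-3)] by blast
  have "norm (char_mangoldt_sum \<psi> N) \<le> (C + 4 * real m * ln 4) / norm (L_one \<psi>)" if N: "N > 0" for N
  proof -
    define P where "P k = (\<Sum>e=1..k. (1 / real e) *\<^sub>R \<psi> e)" for k
    have "(\<Sum>n=1..N. (ln (real n) / real n) *\<^sub>R \<psi> n)
        = (\<Sum>n=1..N. \<Sum>d | d dvd n. ((mangoldt d / real d) *\<^sub>R \<psi> d) * ((1 / real (n div d)) *\<^sub>R \<psi> (n div d)))"
    proof (intro sum.cong refl)
      fix n assume "n \<in> {1..N}"
      hence n: "n > 0" by simp
      have "(ln (real n) / real n) *\<^sub>R \<psi> n = (\<Sum>d | d dvd n. (mangoldt d / real n) *\<^sub>R \<psi> n)"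
        using mangoldt_sum[of n, where ?'a = real] n
        by (simp flip: scaleR_left.sum sum_divide_distrib)
      also have "\<dots> = (\<Sum>d | d dvd n. ((mangoldt d / real d) *\<^sub>R \<psi> d) * ((1 / real (n div d)) *\<^sub>R \<psi> (n div d)))"
      proof (intro sum.cong refl)
        fix d assume "d \<in> {d. d dvd n}"
        then obtain e where e: "n = d * e" by auto
        thus "(mangoldt d / real n) *\<^sub>R \<psi> n = ((mangoldt d / real d) *\<^sub>R \<psi> d) * ((1 / real (n div d)) *\<^sub>R \<psi> (n div d))"
          using n by (simp add: dirichlet_char_mult[OF \<psi>(1)])
      qed
      finally show "(ln (real n) / real n) *\<^sub>R \<psi> n = \<dots>" .
    qed
    also have "\<dots> = (\<Sum>d=1..N. ((mangoldt d / real d) *\<^sub>R \<psi> d) * P (N div d))"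
      unfolding P_def sum_distrib_left
      by (rule sum_divisors_swap[where f = "\<lambda>d e. ((mangoldt d / real d) *\<^sub>R \<psi> d) * ((1 / real e) *\<^sub>R \<psi> e)"])
    finally have 1: "(\<Sum>n=1..N. (ln (real n) / real n) *\<^sub>R \<psi> n)
        = (\<Sum>d=1..N. ((mangoldt d / real d) *\<^sub>R \<psi> d) * P (N div d))" .
    have "norm (\<Sum>d=1..N. ((mangoldt d / real d) *\<^sub>R \<psi> d) * (L_one \<psi> - P (N div d)))
        \<le> (\<Sum>d=1..N. mangoldt d * (2 * real m / real N))"
    proof (rule sum_norm_le)
      fix d assume "d \<in> {1..N}"
      hence d: "d > 0" by simp
      have "norm (L_one \<psi> - P (N div d)) \<le> 2 * real m * (1 / real (Suc (N div d)))"
        using L_one_tail[OF assms(1-3), of "N div d"] by (simp add: P_def)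
      also have "\<dots> \<le> 2 * real m * (real d / real N)"
        by (intro mult_left_mono inverse_Suc_div_le d N) auto
      finally have "norm (L_one \<psi> - P (N div d)) \<le> 2 * real m * (real d / real N)" .
      moreover have "norm ((mangoldt d / real d) *\<^sub>R \<psi> d) \<le> mangoldt d / real d * 1"
        using norm_dirichlet_char_le[OF \<psi>(1) m, of d]
        by (simp add: mangoldt_nonneg divide_right_mono mult_left_le)
      ultimately have "norm (((mangoldt d / real d) *\<^sub>R \<psi> d) * (L_one \<psi> - P (N div d)))
          \<le> (mangoldt d / real d * 1) * (2 * real m * (real d / real N))"
        unfolding norm_mult by (intro mult_mono) (auto simp: mangoldt_nonneg)
      also have "\<dots> = mangoldt d * (2 * real m / real N)" using d by simp
      finally show "norm (((mangoldt d / real d) *\<^sub>R \<psi> d) * (L_one \<psi> - P (N div d)))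
          \<le> mangoldt d * (2 * real m / real N)" .
    qed
    also have "\<dots> = (\<Sum>d=1..N. mangoldt d) * (2 * real m / real N)" by (rule sum_distrib_right[symmetric])
    also have "\<dots> \<le> (2 * ln 4 * real N) * (2 * real m / real N)"
      by (intro mult_right_mono Chebyshev_bound) auto
    also have "\<dots> = 4 * real m * ln 4" using N by simp
    finally have 2: "norm (\<Sum>d=1..N. ((mangoldt d / real d) *\<^sub>R \<psi> d) * (L_one \<psi> - P (N div d))) \<le> 4 * real m * ln 4" .
    have "char_mangoldt_sum \<psi> N * L_one \<psi> = (\<Sum>d=1..N. ((mangoldt d / real d) *\<^sub>R \<psi> d) * (L_one \<psi> - P (N div d)))
        + (\<Sum>n=1..N. (ln (real n) / real n) *\<^sub>R \<psi> n)"
      unfolding 1 char_mangoldt_sum_def sum_distrib_right sum.distrib[symmetric]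
      by (intro sum.cong refl) (simp add: algebra_simps)
    hence "norm (char_mangoldt_sum \<psi> N * L_one \<psi>) \<le> 4 * real m * ln 4 + C"
      using norm_triangle_mono[OF 2 C[of N]] by simp
    thus ?thesis using L by (simp add: norm_mult pos_le_divide_eq)
  qed
  thus ?thesis by blast
qed

text \<open>The Moebius identity replaces \<open>mangoldt d\<close> by
  \<open>moebius_mu d * ln (N / d)\<close>. As the full series is \<open>0\<close>, its partial sums
  are mere tails of size \<open>2 * m * d / N\<close>, and the sum of \<open>ln (N / d)\<close> is
  at most \<open>N\<close> by the lower bound for \<open>ln (fact N)\<close>.\<close>

lemma char_mangoldt_sum_L_one_eq_0:
  assumes \<psi>: "\<psi> \<in> dirichlet_chars m" "\<psi> \<noteq> principal_char m" and m: "m > 0" and L: "L_one \<psi> = 0"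
    and N: "N > 0"
  shows "norm (char_mangoldt_sum \<psi> N + of_real (ln (real N))) \<le> 2 * real m"
proof -
  define P where "P k = (\<Sum>e=1..k. (1 / real e) *\<^sub>R \<psi> e)" for k
  have "(\<Sum>n=1..N. (((if n = 1 then ln (real N) else 0) + mangoldt n) / real n) *\<^sub>R \<psi> n)
      = (\<Sum>n=1..N. \<Sum>d | d dvd n. ((moebius_mu d * ln (real N / real d) / real d) *\<^sub>R \<psi> d)
            * ((1 / real (n div d)) *\<^sub>R \<psi> (n div d)))"
  proof (intro sum.cong refl)
    fix n assume "n \<in> {1..N}"
    hence n: "n > 0" by simp
    have "(((if n = 1 then ln (real N) else 0) + mangoldt n) / real n) *\<^sub>R \<psi> n
        = (\<Sum>d | d dvd n. (moebius_mu d * ln (real N / real d) / real n) *\<^sub>R \<psi> n)"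
      unfolding sum_moebius_mu_ln[OF n N, symmetric]
      by (simp flip: scaleR_left.sum sum_divide_distrib)
    also have "\<dots> = (\<Sum>d | d dvd n. ((moebius_mu d * ln (real N / real d) / real d) *\<^sub>R \<psi> d)
        * ((1 / real (n div d)) *\<^sub>R \<psi> (n div d)))"
    proof (intro sum.cong refl)
      fix d assume "d \<in> {d. d dvd n}"
      then obtain e where e: "n = d * e" by auto
      thus "(moebius_mu d * ln (real N / real d) / real n) *\<^sub>R \<psi> n
          = ((moebius_mu d * ln (real N / real d) / real d) *\<^sub>R \<psi> d) * ((1 / real (n div d)) *\<^sub>R \<psi> (n div d))"
        using n by (simp add: dirichlet_char_mult[OF \<psi>(1)])
    qed
    finally show "(((if n = 1 then ln (real N) else 0) + mangoldt n) / real n) *\<^sub>R \<psi> n = \<dots>" .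
  qed
  also have "\<dots> = (\<Sum>d=1..N. ((moebius_mu d * ln (real N / real d) / real d) *\<^sub>R \<psi> d) * P (N div d))"
    unfolding P_def sum_distrib_left
    by (rule sum_divisors_swap[where f = "\<lambda>d e. ((moebius_mu d * ln (real N / real d) / real d) *\<^sub>R \<psi> d)
          * ((1 / real e) *\<^sub>R \<psi> e)"])
  also have "(\<Sum>n=1..N. (((if n = 1 then ln (real N) else 0) + mangoldt n) / real n) *\<^sub>R \<psi> n)
      = (\<Sum>n=1..N. (if n = 1 then of_real (ln (real N)) else 0) + (mangoldt n / real n) *\<^sub>R \<psi> n)"
    using dirichlet_char_1[OF \<psi>(1)]
    by (intro sum.cong refl) (auto simp: scaleR_conv_of_real)
  also have "\<dots> = char_mangoldt_sum \<psi> N + of_real (ln (real N))"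
    using N by (simp add: sum.distrib char_mangoldt_sum_def)
  finally have 1: "char_mangoldt_sum \<psi> N + of_real (ln (real N))
      = (\<Sum>d=1..N. ((moebius_mu d * ln (real N / real d) / real d) *\<^sub>R \<psi> d) * P (N div d))" .
  also have "norm \<dots> \<le> (\<Sum>d=1..N. ln (real N / real d) * (2 * real m / real N))"
  proof (rule sum_norm_le)
    fix d assume "d \<in> {1..N}"
    hence d: "d > 0" "d \<le> N" by simp_all
    have ln0: "ln (real N / real d) \<ge> 0" using d by simp
    have "norm (P (N div d)) \<le> 2 * real m * (1 / real (Suc (N div d)))"
      using L_one_tail[OF assms(1-3), of "N div d"] by (simp add: P_def L)
    also have "\<dots> \<le> 2 * real m * (real d / real N)"
      by (intro mult_left_mono inverse_Suc_div_le d N) auto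
    finally have a: "norm (P (N div d)) \<le> 2 * real m * (real d / real N)" .
    have "\<bar>moebius_mu d\<bar> * (ln (real N / real d) / real d) \<le> 1 * (ln (real N / real d) / real d)"
      using ln0 by (intro mult_right_mono abs_moebius_mu_le) auto
    hence "\<bar>moebius_mu d * ln (real N / real d) / real d\<bar> * norm (\<psi> d) \<le> (ln (real N / real d) / real d) * 1"
      using norm_dirichlet_char_le[OF \<psi>(1) m, of d] ln0 by (intro mult_mono) (auto simp: abs_mult)
    hence "norm ((moebius_mu d * ln (real N / real d) / real d) *\<^sub>R \<psi> d) \<le> ln (real N / real d) / real d"
      by simp
    hence "norm (((moebius_mu d * ln (real N / real d) / real d) *\<^sub>R \<psi> d) * P (N div d))
        \<le> (ln (real N / real d) / real d) * (2 * real m * (real d / real N))"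
      unfolding norm_mult using a ln0 by (intro mult_mono) auto
    also have "\<dots> = ln (real N / real d) * (2 * real m / real N)" using d by simp
    finally show "norm (((moebius_mu d * ln (real N / real d) / real d) *\<^sub>R \<psi> d) * P (N div d))
        \<le> ln (real N / real d) * (2 * real m / real N)" .
  qed
  also have "\<dots> = (real N * ln (real N) - ln (fact N)) * (2 * real m / real N)"
  proof -
    have "ln (fact N :: real) = (\<Sum>n=1..N. ln (real n))"
      unfolding fact_prod of_nat_prod by (subst ln_prod) auto
    moreover have "(\<Sum>d=1..N. ln (real N / real d)) = (\<Sum>d=1..N. ln (real N) - ln (real d))"
      using N by (intro sum.cong refl) (simp add: ln_div)
    ultimately have "(\<Sum>d=1..N. ln (real N / real d)) = real N * ln (real N) - ln (fact N)"
      by (simp add: sum_subtractf)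
    thus ?thesis by (simp only: sum_distrib_right[symmetric])
  qed
  also have "\<dots> \<le> real N * (2 * real m / real N)"
    using ln_fact_ge[of N] by (intro mult_right_mono) auto
  also have "\<dots> = 2 * real m" using N by simp
  finally show ?thesis .
qed

text \<open>The terms lost from \<open>Mertens_mangoldt\<close> are those not coprime to
  \<open>m\<close>: they are at non-primes, where the sum is bounded, or at the finitely many
  divisors of \<open>m\<close>.\<close>

lemma char_mangoldt_sum_principal:
  assumes m: "m > 0"
  shows "\<exists>C. \<forall>N>0. norm (char_mangoldt_sum (principal_char m) N - of_real (ln (real N))) \<le> C"
proof -
  obtain C where C: "\<And>N. (\<Sum>n | n \<in> {1..N} \<and> \<not> prime n. mangoldt n / real n) \<le> C"
    using sum_nonprime_mangoldt_bounded by blast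
  define D where "D = (\<Sum>p | p dvd m. mangoldt p / real p :: real)"
  have "norm (char_mangoldt_sum (principal_char m) N - of_real (ln (real N))) \<le> 2 * ln 4 + (C + D)"
    if N: "N > 0" for N
  proof -
    define E where "E = (\<Sum>n | n \<in> {1..N} \<and> \<not> coprime n m. mangoldt n / real n :: real)"
    have "(\<Sum>n=1..N. mangoldt n / real n) = (\<Sum>n | n \<in> {1..N} \<and> coprime n m. mangoldt n / real n) + E"
      unfolding E_def by (subst sum.union_disjoint[symmetric]) (auto intro!: sum.cong)
    also have "(\<Sum>n | n \<in> {1..N} \<and> coprime n m. mangoldt n / real n)
        = (\<Sum>n=1..N. mangoldt n / real n * (if coprime n m then 1 else 0))"
      by (intro sum.mono_neutral_cong_left) auto
    finally have 1: "(\<Sum>n=1..N. mangoldt n / real n * (if coprime n m then 1 else 0))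
        = (\<Sum>n=1..N. mangoldt n / real n) - E" by simp
    have "char_mangoldt_sum (principal_char m) N
        = of_real (\<Sum>n=1..N. mangoldt n / real n * (if coprime n m then 1 else 0))"
      unfolding char_mangoldt_sum_def of_real_sum
      by (intro sum.cong refl) (auto simp: principal_char_def scaleR_conv_of_real)
    hence eq: "char_mangoldt_sum (principal_char m) N - of_real (ln (real N))
        = of_real ((\<Sum>n=1..N. mangoldt n / real n) - ln (real N) - E)"
      by (simp only: 1 of_real_diff) simp
    have E0: "0 \<le> E" unfolding E_def by (intro sum_nonneg) (auto simp: mangoldt_nonneg)
    have "E \<le> (\<Sum>n\<in>{n. n \<in> {1..N} \<and> \<not> prime n} \<union> {p. p dvd m}. mangoldt n / real n)"
      unfolding E_def
    proof (intro sum_mono2)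
      show "finite ({n. n \<in> {1..N} \<and> \<not> prime n} \<union> {p. p dvd m})" using m by simp
      show "{n \<in> {1..N}. \<not> coprime n m} \<subseteq> {n. n \<in> {1..N} \<and> \<not> prime n} \<union> {p. p dvd m}"
        using prime_imp_coprime by blast
    qed (auto simp: mangoldt_nonneg)
    also have "\<dots> \<le> (\<Sum>n | n \<in> {1..N} \<and> \<not> prime n. mangoldt n / real n) + D"
      unfolding D_def using m
      by (subst sum.union_inter[symmetric]) (auto intro!: sum_nonneg simp: mangoldt_nonneg)
    also have "\<dots> \<le> C + D" using C by simp
    finally have "E \<le> C + D" .
    thus ?thesis using E0 Mertens_mangoldt[OF N] unfolding eq norm_of_real by linarith
  qed
  thus ?thesis by blast
qed

text \<open>The coefficient of \<open>ln N\<close> in the growth of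
  \<open>char_mangoldt_sum \<psi> N\<close>.\<close>

definition char_weight :: "nat \<Rightarrow> (nat \<Rightarrow> complex) \<Rightarrow> real" where
  "char_weight m \<psi> = (if \<psi> = principal_char m then 1 else if L_one \<psi> = 0 then -1 else 0)"

lemma char_mangoldt_sum_asymp:
  assumes "\<psi> \<in> dirichlet_chars m" "m > 0"
  shows "\<exists>C. \<forall>N>0. norm (char_mangoldt_sum \<psi> N - of_real (char_weight m \<psi> * ln (real N))) \<le> C"
  using char_mangoldt_sum_principal[of m] char_mangoldt_sum_L_one_eq_0[of \<psi> m]
    char_mangoldt_sum_bounded[of \<psi> m] assms
  by (cases "\<psi> = principal_char m"; cases "L_one \<psi> = 0") (auto simp: char_weight_def)

text \<open>Orthogonality of characters. The weights are kept general because the case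
  \<open>a = 1\<close> serves to prove that no value \<open>L_one \<psi>\<close> vanishes.\<close>

lemma mangoldt_sum_ap_asymp:
  assumes m: "m > 0" and a: "coprime a m"
  shows "\<exists>C. \<forall>N>0. norm (of_real (real (totient m) * (\<Sum>n | n \<in> {1..N} \<and> [n = a] (mod m). mangoldt n / real n))
      - (\<Sum>\<psi>\<in>dirichlet_chars m. cnj (\<psi> a) * of_real (char_weight m \<psi>)) * of_real (ln (real N))) \<le> C"
proof -
  obtain C where C: "\<And>\<psi> N. \<psi> \<in> dirichlet_chars m \<Longrightarrow> N > 0 \<Longrightarrow>
      norm (char_mangoldt_sum \<psi> N - of_real (char_weight m \<psi> * ln (real N))) \<le> C \<psi>"
    using char_mangoldt_sum_asymp[OF _ m] by metis
  have "norm (of_real (real (totient m) * (\<Sum>n | n \<in> {1..N} \<and> [n = a] (mod m). mangoldt n / real n))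
      - (\<Sum>\<psi>\<in>dirichlet_chars m. cnj (\<psi> a) * of_real (char_weight m \<psi>)) * of_real (ln (real N)))
      \<le> (\<Sum>\<psi>\<in>dirichlet_chars m. C \<psi>)" if N: "N > 0" for N
  proof -
    have "of_real (real (totient m) * (\<Sum>n | n \<in> {1..N} \<and> [n = a] (mod m). mangoldt n / real n))
        = (\<Sum>n=1..N. (mangoldt n / real n) *\<^sub>R (if [n = a] (mod m) then of_nat (totient m) else (0::complex)))"
      unfolding sum_distrib_left of_real_sum
      by (intro sum.mono_neutral_cong_left) (auto simp: scaleR_conv_of_real)
    also have "\<dots> = (\<Sum>n=1..N. (mangoldt n / real n) *\<^sub>R (\<Sum>\<psi>\<in>dirichlet_chars m. cnj (\<psi> a) * \<psi> n))"
      by (simp add: dirichlet_char_orthogonality[OF assms])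
    also have "\<dots> = (\<Sum>\<psi>\<in>dirichlet_chars m. cnj (\<psi> a) * char_mangoldt_sum \<psi> N)"
      unfolding scaleR_sum_right char_mangoldt_sum_def sum_distrib_left by (subst sum.swap) simp
    finally have "of_real (real (totient m) * (\<Sum>n | n \<in> {1..N} \<and> [n = a] (mod m). mangoldt n / real n))
        - (\<Sum>\<psi>\<in>dirichlet_chars m. cnj (\<psi> a) * of_real (char_weight m \<psi>)) * of_real (ln (real N))
        = (\<Sum>\<psi>\<in>dirichlet_chars m. cnj (\<psi> a) * (char_mangoldt_sum \<psi> N - of_real (char_weight m \<psi> * ln (real N))))"
      by (simp add: sum_distrib_right sum_subtractf right_diff_distrib mult.assoc)
    also have "norm \<dots> \<le> (\<Sum>\<psi>\<in>dirichlet_chars m. C \<psi>)"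
    proof (rule sum_norm_le)
      fix \<psi> assume \<psi>: "\<psi> \<in> dirichlet_chars m"
      have "norm (cnj (\<psi> a)) * norm (char_mangoldt_sum \<psi> N - of_real (char_weight m \<psi> * ln (real N))) \<le> 1 * C \<psi>"
        using norm_dirichlet_char_le[OF \<psi> m, of a] C[OF \<psi> N] by (intro mult_mono) auto
      thus "norm (cnj (\<psi> a) * (char_mangoldt_sum \<psi> N - of_real (char_weight m \<psi> * ln (real N)))) \<le> C \<psi>"
        by (simp add: norm_mult)
    qed
    finally show ?thesis .
  qed
  thus ?thesis by blast
qed

section \<open>Nonvanishing for real characters\<close>

text \<open>Every divisor is uniquely \<open>p ^ i * d\<close> with \<open>i \<le> a\<close> and
  \<open>d\<close> dividing \<open>u\<close>, so the sum factors.\<close>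

lemma sum_mult_divisors_prime_power_mult:
  fixes r :: "nat \<Rightarrow> real"
  assumes mult: "\<And>a b. r (a * b) = r a * r b" and one: "r 1 = 1" and p: "prime p" "\<not> p dvd u"
  shows "(\<Sum>d | d dvd p ^ a * u. r d) = (\<Sum>i\<le>a. r p ^ i) * (\<Sum>d | d dvd u. r d)"
proof -
  have pow: "r (p ^ i) = r p ^ i" for i using one by (induction i) (simp_all add: mult)
  have inj: "i = j \<and> d = e" if "d dvd u" "e dvd u" "p ^ i * d = p ^ j * e" for i j d e
  proof -
    have npd: "\<not> p dvd d" "\<not> p dvd e" using that p(2) dvd_trans by blast+
    have "multiplicity p (p ^ i * d) = i" "multiplicity p (p ^ j * e) = j"
      using p(1) npd by (auto intro!: multiplicity_eqI simp: power_Suc2 prime_gt_0_nat simp del: power_Suc)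
    hence "i = j" using that(3) by simp
    thus ?thesis using that(3) p(1) by auto
  qed
  have bij: "bij_betw (\<lambda>x. p ^ fst x * snd x) ({..a} \<times> {d. d dvd u}) {d. d dvd p ^ a * u}"
    unfolding bij_betw_def
  proof
      show "inj_on (\<lambda>x. p ^ fst x * snd x) ({..a} \<times> {d. d dvd u})"
      proof (rule inj_onI)
        fix x y assume "x \<in> {..a} \<times> {d. d dvd u}" "y \<in> {..a} \<times> {d. d dvd u}"
          "p ^ fst x * snd x = p ^ fst y * snd y"
        thus "x = y" using inj[of "snd x" "snd y" "fst x" "fst y"] by (auto simp: prod_eq_iff)
      qed
      show "(\<lambda>x. p ^ fst x * snd x) ` ({..a} \<times> {d. d dvd u}) = {d. d dvd p ^ a * u}"
      proof (intro equalityI subsetI)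
        fix d assume "d \<in> {d. d dvd p ^ a * u}"
        then obtain b c where "d = b * c" "b dvd p ^ a" "c dvd u" using division_decomp by blast
        moreover from this obtain i where "i \<le> a" "b = p ^ i" using divides_primepow_nat[OF p(1)] by blast
        ultimately show "d \<in> (\<lambda>x. p ^ fst x * snd x) ` ({..a} \<times> {d. d dvd u})" by force
      qed (auto intro!: mult_dvd_mono le_imp_power_dvd)
  qed
  have "(\<Sum>d | d dvd p ^ a * u. r d) = (\<Sum>(i,d)\<in>{..a} \<times> {d. d dvd u}. r (p ^ i * d))"
    using sum.reindex_bij_betw[OF bij, of r] by (simp add: case_prod_unfold)
  also have "\<dots> = (\<Sum>i\<le>a. r p ^ i) * (\<Sum>d | d dvd u. r d)"
    by (simp add: mult pow sum_product sum.cartesian_product)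
  finally show ?thesis .
qed

lemma sum_powers_sign:
  fixes t :: real
  assumes "t \<in> {-1, 0, 1}"
  shows "(\<Sum>i\<le>a. t ^ i) \<ge> 0" "even a \<Longrightarrow> (\<Sum>i\<le>a. t ^ i) \<ge> 1"
proof -
  have "(\<Sum>i\<le>a. (-1::real) ^ i) = (if even a then 1 else 0)" by (induction a) auto
  moreover have "(\<Sum>i\<le>a. (0::real) ^ i) = 1" by (induction a) auto
  ultimately show "(\<Sum>i\<le>a. t ^ i) \<ge> 0" "even a \<Longrightarrow> (\<Sum>i\<le>a. t ^ i) \<ge> 1"
    using assms by auto
qed

text \<open>Both sums factor over prime powers. A factor is a sum of powers of \<open>-1\<close>,
  \<open>0\<close> or \<open>1\<close>, hence nonnegative, and at least \<open>1\<close> for an even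
  exponent. The induction removes the full power of one prime.\<close>

lemma sum_real_char_divisors:
  fixes r :: "nat \<Rightarrow> real"
  assumes mult: "\<And>a b. r (a * b) = r a * r b" and one: "r 1 = 1" and vals: "\<And>a. r a \<in> {-1, 0, 1}"
    and "n > 0"
  shows "(\<Sum>d | d dvd n. r d) \<ge> 0 \<and> (\<Sum>d | d dvd n ^ 2. r d) \<ge> 1"
  using \<open>n > 0\<close>
proof (induction n rule: less_induct)
  case (less n)
  show ?case
  proof (cases "n = 1")
    case False
    then obtain p where p: "prime p" "p dvd n" using prime_factor_nat by blast
    obtain u where u: "n = p ^ multiplicity p n * u" "\<not> p dvd u"
      by (rule multiplicity_decompose'[of n p]) (use less.prems p(1) in \<open>auto simp: not_prime_unit\<close>)
    define a where "a = multiplicity p n"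
    have n: "n = p ^ a * u" using u by (simp add: a_def)
    have "a > 0" using p less.prems unfolding a_def by (simp add: prime_multiplicity_gt_zero_iff prime_elem_multiplicity_eq_zero_iff Nat.gr0I)
    hence "p ^ a > 1" using prime_gt_1_nat[OF p(1)] by (rule one_less_power[rotated])
    moreover have "u > 0" using n less.prems by (auto intro: Nat.gr0I)
    ultimately have "u < n" using n by simp
    from less.IH[OF this \<open>u > 0\<close>]
    have IH: "(\<Sum>d | d dvd u. r d) \<ge> 0" "(\<Sum>d | d dvd u ^ 2. r d) \<ge> 1" by auto
    have n2: "n ^ 2 = p ^ (2 * a) * u ^ 2" by (simp add: n power_mult_distrib power_mult[symmetric] mult.commute)
    have pu2: "\<not> p dvd u ^ 2" using u(2) p(1) prime_dvd_power by blast
    have "(\<Sum>d | d dvd n. r d) \<ge> 0"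
      unfolding n sum_mult_divisors_prime_power_mult[OF mult one p(1) u(2)]
      by (intro mult_nonneg_nonneg sum_powers_sign(1) vals IH)
    moreover have "(\<Sum>i\<le>2 * a. r p ^ i) * (\<Sum>d | d dvd u ^ 2. r d) \<ge> 1 * 1"
      using sum_powers_sign(2)[OF vals, of "2 * a" p] IH by (intro mult_mono) auto
    hence "(\<Sum>d | d dvd n ^ 2. r d) \<ge> 1"
      unfolding n2 sum_mult_divisors_prime_power_mult[OF mult one p(1) pu2] by simp
    ultimately show ?thesis by blast
  qed (use one in auto)
qed

text \<open>Arithmetic and geometric mean: the terms \<open>x ^ i\<close> and
  \<open>x ^ (d - i)\<close> together are at least \<open>2 * sqrt x ^ d\<close>.\<close>

lemma sum_powers_ge:
  fixes x :: real
  assumes "0 < x" "x < 1"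
  shows "real (Suc d) * sqrt x ^ d \<le> (\<Sum>i<Suc d. x ^ i)"
proof -
  define y where "y = sqrt x"
  have y: "x = y ^ 2" using assms by (simp add: y_def)
  have "2 * (real (Suc d) * y ^ d) = (\<Sum>i<Suc d. 2 * y ^ d)" by simp
  also have "\<dots> \<le> (\<Sum>i<Suc d. x ^ i + x ^ (Suc d - Suc i))"
  proof (rule sum_mono)
    fix i assume "i \<in> {..<Suc d}"
    hence i: "i + (Suc d - Suc i) = d" by auto
    have "2 * y ^ d = 2 * y ^ i * y ^ (Suc d - Suc i)"
      by (subst i[symmetric]) (simp add: power_add)
    also have "\<dots> \<le> (y ^ i)\<^sup>2 + (y ^ (Suc d - Suc i))\<^sup>2" by (rule sum_squares_bound)
    also have "\<dots> = x ^ i + x ^ (Suc d - Suc i)" by (simp add: y power_mult[symmetric] mult.commute)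
    finally show "2 * y ^ d \<le> x ^ i + x ^ (Suc d - Suc i)" .
  qed
  also have "\<dots> = 2 * (\<Sum>i<Suc d. x ^ i)"
    unfolding sum.distrib sum.nat_diff_reindex[of "\<lambda>i. x ^ i"] by simp
  finally show ?thesis by (simp add: y_def)
qed

text \<open>Since \<open>1 - x ^ d = (1 - x) * s d\<close>, the quotient \<open>x ^ d / s d\<close>
  is the Lambert term \<open>x ^ d / (1 - x ^ d)\<close> times \<open>1 - x\<close>, and
  \<open>b\<close> compares it with \<open>1 / d\<close>. A step of \<open>b\<close> is
  \<open>1 / (d * (d + 1)) - x ^ d / (s d * s (d + 1))\<close>; its sign follows from
  \<open>d * sqrt x ^ d \<le> s d\<close> and the same bound for \<open>d + 1\<close>.\<close>

lemma
  fixes x :: real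
  assumes x: "0 < x" "x < 1"
  defines "s \<equiv> \<lambda>d. \<Sum>i<d. x ^ i"
  defines "b \<equiv> \<lambda>d. 1 / real d - x ^ d / s d"
  assumes d: "d > 0"
  shows Monsky_antimono: "b (Suc d) \<le> b d" and Monsky_nonneg: "b d \<ge> 0"
proof -
  have s0: "s k > 0" if "k > 0" for k
    unfolding s_def using that x by (intro sum_pos) auto
  have s_rec: "s (Suc d) = 1 + x * s d"
    unfolding s_def sum.lessThan_Suc_shift by (simp add: sum_distrib_left)
  have sq: "sqrt x ^ d * sqrt x ^ d = x ^ d" using x by (simp flip: power_mult_distrib)
  have sq0: "0 \<le> sqrt x ^ d" "sqrt x ^ d \<le> 1" using x by (auto intro: power_le_one)
  have "real (Suc d) * sqrt x ^ d \<le> s (Suc d)" using sum_powers_ge[OF x, of d] by (simp add: s_def)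
  moreover have "real d * sqrt x ^ d \<le> s d"
  proof -
    have "real d * sqrt x ^ d \<le> real d * sqrt x ^ (d - 1)"
      using x by (intro mult_left_mono power_decreasing) auto
    also have "\<dots> \<le> s d" using sum_powers_ge[OF x, of "d - 1"] d by (simp add: s_def)
    finally show ?thesis .
  qed
  ultimately have "(real d * sqrt x ^ d) * (real (Suc d) * sqrt x ^ d) \<le> s d * s (Suc d)"
    using sq0 s0[OF d] by (intro mult_mono) auto
  hence key: "real d * real (Suc d) * x ^ d \<le> s d * s (Suc d)"
    by (simp add: sq[symmetric] mult_ac)
  have "b d - b (Suc d) = 1 / (real d * real (Suc d)) - x ^ d / (s d * s (Suc d))"
  proof -
    have "1 / real d - 1 / real (Suc d) = 1 / (real d * real (Suc d))"
      using d by (simp add: field_simps)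
    moreover have "x ^ d / s d - x ^ Suc d / s (Suc d) = x ^ d * (s (Suc d) - x * s d) / (s d * s (Suc d))"
      using s0[of d] s0[of "Suc d"] d by (simp add: field_simps)
    ultimately show ?thesis by (simp add: b_def s_rec)
  qed
  also have "\<dots> \<ge> 0"
    using key d s0[of d] s0[of "Suc d"] by (simp add: divide_simps mult.commute split: if_splits)
  finally show "b (Suc d) \<le> b d" by simp
  have "real d * x ^ d \<le> s d"
  proof -
    have "(\<Sum>i<d. x ^ d) \<le> s d" unfolding s_def using x by (intro sum_mono power_decreasing) auto
    thus ?thesis by simp
  qed
  thus "b d \<ge> 0" using d s0[OF d] by (simp add: b_def field_simps)
qed

lemma geometric_sum_from_1:
  fixes z :: real
  shows "(1 - z) * (\<Sum>e=1..q. z ^ e) = z - z ^ Suc q"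
proof (induction q)
  case (Suc q)
  have "(1 - z) * (\<Sum>e=1..Suc q. z ^ e) = (1 - z) * (\<Sum>e=1..q. z ^ e) + (1 - z) * z ^ Suc q"
    by (simp add: distrib_left)
  thus ?case unfolding Suc.IH by (simp add: left_diff_distrib)
qed simp

text \<open>Monsky's argument: if the value vanished, the Lambert series of \<open>\<psi>\<close> would stay bounded as
  \<open>x\<close> tends to \<open>1\<close>, whereas its power series coefficients are nonnegative, and at least \<open>1\<close> at squares.\<close>

lemma L_one_real_char_nonzero:
  assumes \<psi>: "\<psi> \<in> dirichlet_chars m" "\<psi> \<noteq> principal_char m" and m: "m > 0"
    and real: "\<And>n. cnj (\<psi> n) = \<psi> n"
  shows "L_one \<psi> \<noteq> 0"
proof
  assume L: "L_one \<psi> = 0"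
  define r where "r n = Re (\<psi> n)" for n
  have \<psi>r: "\<psi> n = of_real (r n)" for n
    using real[of n] by (simp add: r_def complex_eq_iff)
  have mult: "r (a * b) = r a * r b" for a b
    using dirichlet_char_mult[OF \<psi>(1), of a b] unfolding \<psi>r by (simp flip: of_real_mult)
  have one: "r 1 = 1" using dirichlet_char_1[OF \<psi>(1)] by (simp add: r_def)
  have vals: "r a \<in> {-1, 0, 1}" for a
    using norm_dirichlet_char[OF \<psi>(1) m, of a] dirichlet_char_eq_0_iff[OF \<psi>(1), of a]
    by (auto simp: \<psi>r)
  have r1: "\<bar>r a\<bar> \<le> 1" for a using vals[of a] by auto
  define c where "c n = (\<Sum>d | d dvd n. r d)" for n
  have c: "c n \<ge> 0" "c (n ^ 2) \<ge> 1" if "n > 0" for n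
    using sum_real_char_divisors[OF mult one vals that] by (auto simp: c_def)
  have bound: "(\<Sum>k=1..K. x ^ (k ^ 2)) \<le> 2 * real m" if x: "0 < x" "x < 1" for x :: real and K
  proof -
    define s where "s d = (\<Sum>i<d. x ^ i)" for d
    define b where "b d = 1 / real d - x ^ d / s d" for d
    have b: "b (Suc d) \<le> b d" "b d \<ge> 0" if "d \<ge> 1" for d
      using Monsky_antimono[OF x, of d] Monsky_nonneg[OF x, of d] that by (simp_all add: b_def s_def)
    have s1: "s d \<ge> 1" if "d > 0" for d
    proof -
      have "(\<Sum>i<1. x ^ i) \<le> s d" unfolding s_def using that x by (intro sum_mono2) auto
      thus ?thesis by simp
    qed
    \<comment> \<open>Truncation at \<open>M\<close>. The first two errors are the tail of
      \<open>L_one \<psi> = 0\<close> and Dirichlet's bound \<open>2 * m * b 1\<close> with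
      \<open>b 1 = 1 - x\<close>; the third collects the remainders of \<open>M\<close> truncated
      geometric series, each at most \<open>x ^ M\<close>.\<close>
    have fin: "(1 - x) * (\<Sum>k=1..K. x ^ (k ^ 2)) \<le> 2 * real m / real (Suc M) + 2 * real m * (1 - x) + real M * x ^ M"
      if M: "M \<ge> K ^ 2" for M
    proof -
      have "(\<Sum>k=1..K. x ^ (k ^ 2)) \<le> (\<Sum>k=1..K. c (k ^ 2) * x ^ (k ^ 2))"
      proof (rule sum_mono)
        fix k assume "k \<in> {1..K}"
        hence "1 * x ^ (k ^ 2) \<le> c (k ^ 2) * x ^ (k ^ 2)" using x c(2)[of k] by (intro mult_right_mono) auto
        thus "x ^ (k ^ 2) \<le> c (k ^ 2) * x ^ (k ^ 2)" by simp
      qed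
      also have "\<dots> = (\<Sum>n\<in>(\<lambda>k. k ^ 2) ` {1..K}. c n * x ^ n)"
        by (subst sum.reindex) (auto simp: inj_on_def power2_eq_iff_nonneg)
      also have "\<dots> \<le> (\<Sum>n=1..M. c n * x ^ n)"
      proof (intro sum_mono2)
        show "(\<lambda>k. k ^ 2) ` {1..K} \<subseteq> {1..M}"
          using M by (auto simp: Suc_le_eq intro: order_trans[OF power_mono[of _ K 2]])
        show "0 \<le> c n * x ^ n" if "n \<in> {1..M} - (\<lambda>k. k ^ 2) ` {1..K}" for n
          using that c(1)[of n] x by auto
      qed auto
      also have "\<dots> = (\<Sum>n=1..M. \<Sum>d | d dvd n. r d * (x ^ d) ^ (n div d))"
        unfolding c_def sum_distrib_right
        by (intro sum.cong refl) (auto simp flip: power_mult)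
      also have "\<dots> = (\<Sum>d=1..M. r d * (\<Sum>e=1..M div d. (x ^ d) ^ e))"
        unfolding sum_distrib_left by (rule sum_divisors_swap[where f = "\<lambda>d e. r d * (x ^ d) ^ e"])
      finally have "(1 - x) * (\<Sum>k=1..K. x ^ (k ^ 2)) \<le> (1 - x) * \<dots>"
        using x by (intro mult_left_mono) auto
      also have "\<dots> = (\<Sum>d=1..M. (1 - x) * (r d * (\<Sum>e=1..M div d. (x ^ d) ^ e)))"
        by (rule sum_distrib_left)
      also have "\<dots> = (\<Sum>d=1..M. r d * (x ^ d / s d) - r d * (x ^ (d * Suc (M div d)) / s d))"
      proof (intro sum.cong refl)
        fix d assume "d \<in> {1..M}"
        hence d: "d > 0" by simp
        define z q where "z = x ^ d" and "q = M div d"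
        have "(1 - z) * (\<Sum>e=1..q. z ^ e) = z - z ^ Suc q"
          by (rule geometric_sum_from_1)
        moreover have "1 - z = (1 - x) * s d" by (simp add: z_def s_def one_diff_power_eq)
        ultimately have "(1 - x) * (\<Sum>e=1..q. z ^ e) = (z - z ^ Suc q) / s d"
          using s1[OF d] by (simp add: field_simps)
        moreover have "z ^ Suc q = x ^ (d * Suc (M div d))" by (simp only: z_def q_def power_mult)
        ultimately have "(1 - x) * (\<Sum>e=1..M div d. (x ^ d) ^ e) = (x ^ d - x ^ (d * Suc (M div d))) / s d"
          by (simp only: z_def q_def)
        hence "r d * ((1 - x) * (\<Sum>e=1..M div d. (x ^ d) ^ e)) = r d * ((x ^ d - x ^ (d * Suc (M div d))) / s d)"
          by simp
        thus "(1 - x) * (r d * (\<Sum>e=1..M div d. (x ^ d) ^ e))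
            = r d * (x ^ d / s d) - r d * (x ^ (d * Suc (M div d)) / s d)"
          unfolding diff_divide_distrib right_diff_distrib[of "r d"] by (simp only: mult.left_commute)
      qed
      also have "\<dots> = (\<Sum>d=1..M. r d * (x ^ d / s d)) - (\<Sum>d=1..M. r d * (x ^ (d * Suc (M div d)) / s d))"
        by (rule sum_subtractf)
      also have "\<dots> \<le> \<bar>\<Sum>d=1..M. r d * (x ^ d / s d)\<bar> + real M * x ^ M"
      proof -
        have "\<bar>\<Sum>d=1..M. r d * (x ^ (d * Suc (M div d)) / s d)\<bar> \<le> (\<Sum>d=1..M. x ^ M)"
        proof (rule order_trans[OF sum_abs sum_mono])
          fix d assume "d \<in> {1..M}"
          hence d: "d > 0" by simp
          have "M \<le> d * Suc (M div d)" using dividend_less_times_div[OF d, of M] by simp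
          hence "x ^ (d * Suc (M div d)) \<le> x ^ M" using x by (intro power_decreasing) auto
          hence "x ^ (d * Suc (M div d)) / s d \<le> x ^ M / 1"
            using s1[OF d] x by (intro frac_le) auto
          hence "\<bar>r d\<bar> * (x ^ (d * Suc (M div d)) / s d) \<le> 1 * x ^ M"
            using r1[of d] s1[OF d] x by (intro mult_mono) auto
          thus "\<bar>r d * (x ^ (d * Suc (M div d)) / s d)\<bar> \<le> x ^ M"
            using s1[OF d] x by (simp add: abs_mult)
        qed
        thus ?thesis by simp
      qed
      also have "\<bar>\<Sum>d=1..M. r d * (x ^ d / s d)\<bar> \<le> 2 * real m / real (Suc M) + 2 * real m * (1 - x)"
      proof -
        have "norm (\<Sum>i\<in>{1..<Suc M}. b i *\<^sub>R \<psi> i) \<le> 2 * real m * b 1"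
        proof (rule norm_sum_antimono_le)
          fix n
          \<comment> \<open>The index starts at \<open>1\<close> because \<open>b\<close> decreases
            only from there; dropping \<open>\<psi> 0\<close> costs at most \<open>1\<close>, whence
            \<open>2 * m\<close>.\<close>
          have "norm (\<Sum>i\<in>{1..<n}. \<psi> i) \<le> norm (\<Sum>i<n. \<psi> i) + norm (\<psi> 0)"
          proof (cases "n = 0")
            case False
            hence "(\<Sum>i\<in>{1..<n}. \<psi> i) = (\<Sum>i<n. \<psi> i) - \<psi> 0"
              by (simp add: lessThan_atLeast0 sum.atLeast_Suc_lessThan)
            thus ?thesis using norm_triangle_ineq4 by metis
          qed auto
          also have "\<dots> \<le> real m + 1"
            by (intro add_mono norm_sum_dirichlet_char_le norm_dirichlet_char_le[OF \<psi>(1)] assms)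
          also have "\<dots> \<le> 2 * real m" using m by simp
          finally show "norm (\<Sum>i\<in>{1..<n}. \<psi> i) \<le> 2 * real m" .
        qed (use b in auto)
        moreover have "b 1 = 1 - x" by (simp add: b_def s_def)
        moreover have "norm (\<Sum>i=1..M. (1 / real i) *\<^sub>R \<psi> i) \<le> 2 * real m / real (Suc M)"
          using L_one_tail[OF assms(1-3), of M] by (simp add: L)
        ultimately have "norm ((\<Sum>i=1..M. (1 / real i) *\<^sub>R \<psi> i) - (\<Sum>i=1..M. b i *\<^sub>R \<psi> i))
            \<le> 2 * real m / real (Suc M) + 2 * real m * (1 - x)"
          by (intro order_trans[OF norm_triangle_ineq4] add_mono) (simp_all add: atLeastLessThanSuc_atLeastAtMost)
        also have "(\<Sum>i=1..M. (1 / real i) *\<^sub>R \<psi> i) - (\<Sum>i=1..M. b i *\<^sub>R \<psi> i) = of_real (\<Sum>d=1..M. r d * (x ^ d / s d))"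
          unfolding sum_subtractf[symmetric] of_real_sum
          by (intro sum.cong refl) (simp add: b_def \<psi>r scaleR_conv_of_real algebra_simps)
        finally show ?thesis by (simp only: norm_of_real)
      qed
      finally show ?thesis by simp
    qed
    have "(\<lambda>M. 2 * real m / real (Suc M) + 2 * real m * (1 - x) + real M * x ^ M) \<longlonglongrightarrow> 0 + 2 * real m * (1 - x) + 0"
      using x by (intro tendsto_intros LIMSEQ_Suc[OF lim_const_over_n] powser_times_n_limit_0) auto
    hence "(1 - x) * (\<Sum>k=1..K. x ^ (k ^ 2)) \<le> 0 + 2 * real m * (1 - x) + 0"
      by (rule LIMSEQ_le_const) (use fin in blast)
    thus ?thesis using x by (simp add: mult.commute)
  qed
  \<comment> \<open>\<open>bound\<close> is uniform in \<open>x\<close> and in the number of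
    squares, but \<open>2 * m + 1\<close> summands that tend to \<open>1\<close> exceed it.\<close>
  have "((\<lambda>x::real. \<Sum>k=1..2 * m + 1. x ^ (k ^ 2)) \<longlongrightarrow> (\<Sum>k=1..2 * m + 1. 1 ^ (k ^ 2))) (at_left 1)"
    by (intro tendsto_intros)
  hence "(\<Sum>k=1..2 * m + 1. (1::real) ^ (k ^ 2)) \<le> 2 * real m"
    by (rule tendsto_upperbound) (rule eventually_at_leftI[of 0], rule bound, auto)
  thus False by simp
qed

section \<open>Primes in arithmetic progressions\<close>

lemma L_one_cnj: "L_one (\<lambda>n. cnj (\<psi> n)) = cnj (L_one \<psi>)"
  if "\<psi> \<in> dirichlet_chars m" "\<psi> \<noteq> principal_char m" "m > 0"
proof -
  have "summable (\<lambda>n. (1 / real n) *\<^sub>R \<psi> n)"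
    by (rule Dirichlet_test_summable[where a = 1 and B = "real m"])
      (use norm_sum_dirichlet_char_le[OF that] lim_1_over_n in \<open>auto simp: field_simps\<close>)
  hence "(\<lambda>n. (1 / real n) *\<^sub>R \<psi> n) sums L_one \<psi>" unfolding L_one_def by (rule summable_sums)
  hence "(\<lambda>n. cnj ((1 / real n) *\<^sub>R \<psi> n)) sums cnj (L_one \<psi>)" by (simp only: sums_cnj)
  thus ?thesis unfolding L_one_def by (simp add: sums_iff)
qed

text \<open>A non-real \<open>\<psi>\<close> comes with a second character, its conjugate, whose
  value is the conjugate and so vanishes too. The two weights \<open>-1\<close> outweigh the single
  \<open>+1\<close> of the principal character.\<close>

theorem L_one_nonzero:
  assumes \<psi>: "\<psi> \<in> dirichlet_chars m" "\<psi> \<noteq> principal_char m" and m: "m > 0"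
  shows "L_one \<psi> \<noteq> 0"
proof
  assume L: "L_one \<psi> = 0"
  define \<theta> where "\<theta> = (\<lambda>n. cnj (\<psi> n))"
  have \<theta>: "\<theta> \<in> dirichlet_chars m" using dirichlet_chars_cnj[OF \<psi>(1)] by (simp add: \<theta>_def)
  have ne: "\<theta> \<noteq> \<psi>"
    using L_one_real_char_nonzero[OF assms] L by (auto simp: \<theta>_def fun_eq_iff)
  have np: "\<theta> \<noteq> principal_char m"
  proof
    assume "\<theta> = principal_char m"
    hence "\<psi> n = principal_char m n" for n
      by (metis (no_types, lifting) \<theta>_def complex_cnj_cnj complex_cnj_one complex_cnj_zero principal_char_def)
    thus False using \<psi>(2) by blast
  qed
  have L\<theta>: "L_one \<theta> = 0" using L_one_cnj[OF assms] L by (simp add: \<theta>_def)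
  obtain C where C: "\<And>N. N > 0 \<Longrightarrow>
      norm (of_real (real (totient m) * (\<Sum>n | n \<in> {1..N} \<and> [n = 1] (mod m). mangoldt n / real n))
      - (\<Sum>\<psi>\<in>dirichlet_chars m. cnj (\<psi> 1) * of_real (char_weight m \<psi>)) * of_real (ln (real N))) \<le> C"
    using mangoldt_sum_ap_asymp[OF m, of 1] by auto
  define W where "W = (\<Sum>\<psi>\<in>dirichlet_chars m. char_weight m \<psi>)"
  have "(\<Sum>\<psi>\<in>dirichlet_chars m. cnj (\<psi> 1) * of_real (char_weight m \<psi>)) = complex_of_real W"
    unfolding W_def of_real_sum
    by (intro sum.cong refl) (simp add: dirichlet_char_1[simplified])
  hence C': "norm (complex_of_real (real (totient m) * (\<Sum>n | n \<in> {1..N} \<and> [n = 1] (mod m). mangoldt n / real n) - W * ln (real N))) \<le> C"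
    if "N > 0" for N using C[OF that] by simp
  have fin: "finite (dirichlet_chars m)" by (rule finite_dirichlet_chars[OF m])
  \<comment> \<open>\<open>\<psi>\<close>, \<open>\<theta>\<close> and the principal character are
    distinct, and every other weight is at most \<open>0\<close>.\<close>
  have "W \<le> (\<Sum>\<psi>'\<in>dirichlet_chars m. (if \<psi>' = principal_char m then 1 else 0)
      - (if \<psi>' = \<psi> then 1 else 0) - (if \<psi>' = \<theta> then 1 else 0))"
    unfolding W_def using ne np \<psi> L L\<theta> by (intro sum_mono) (auto simp: char_weight_def)
  also have "\<dots> = -1"
    using fin \<psi>(1) \<theta> principal_char_in[OF m] by (simp add: sum_subtractf)
  finally have W: "W \<le> -1" .
  have "ln (real N) \<le> C" if "N > 0" for N
  proof -
    have "0 \<le> real (totient m) * (\<Sum>n | n \<in> {1..N} \<and> [n = 1] (mod m). mangoldt n / real n)"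
      by (intro mult_nonneg_nonneg sum_nonneg) (auto simp: mangoldt_nonneg)
    moreover have "W * ln (real N) \<le> (-1) * ln (real N)"
      using W that by (intro mult_right_mono) auto
    ultimately show ?thesis using C'[OF that] unfolding norm_of_real by linarith
  qed
  \<comment> \<open>This \<open>N\<close> is chosen so that \<open>ln N\<close> is at least
    \<open>C + 1\<close>.\<close>
  from this[of "nat \<lceil>exp (C + 1)\<rceil>"] have "ln (real (nat \<lceil>exp (C + 1)\<rceil>)) \<le> C" by simp
  moreover have "ln (real (nat \<lceil>exp (C + 1)\<rceil>)) \<ge> C + 1"
    by (subst ln_ge_iff) (auto intro: order_less_le_trans[OF exp_gt_zero real_nat_ceiling_ge] real_nat_ceiling_ge)
  ultimately show False by linarith
qed

text \<open>By \<open>L_one_nonzero\<close> only the principal character keeps a nonzero weight, so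
  the coefficient of \<open>ln N\<close> is \<open>1\<close> before division by
  \<open>totient m\<close>. Discarding the proper prime powers costs O(1).\<close>

theorem Mertens_primes_ap:
  assumes m: "m > 0" and a: "coprime a m"
  shows "\<exists>C. \<forall>N>0. \<bar>(\<Sum>p | p \<in> {1..N} \<and> prime p \<and> [p = a] (mod m). ln (real p) / real p)
      - ln (real N) / real (totient m)\<bar> \<le> C"
proof -
  obtain C where C: "\<And>N. N > 0 \<Longrightarrow>
      norm (of_real (real (totient m) * (\<Sum>n | n \<in> {1..N} \<and> [n = a] (mod m). mangoldt n / real n))
      - (\<Sum>\<psi>\<in>dirichlet_chars m. cnj (\<psi> a) * of_real (char_weight m \<psi>)) * of_real (ln (real N))) \<le> C"
    using mangoldt_sum_ap_asymp[OF assms] by auto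
  obtain D where D: "\<And>N. (\<Sum>n | n \<in> {1..N} \<and> \<not> prime n. mangoldt n / real n) \<le> D"
    using sum_nonprime_mangoldt_bounded by blast
  have "(\<Sum>\<psi>\<in>dirichlet_chars m. cnj (\<psi> a) * of_real (char_weight m \<psi>))
      = (\<Sum>\<psi>\<in>{principal_char m}. 1)"
    using m a by (intro sum.mono_neutral_cong_right finite_dirichlet_chars principal_char_in)
      (auto simp: char_weight_def L_one_nonzero principal_char_def principal_char_in)
  hence C': "norm (complex_of_real (real (totient m) * (\<Sum>n | n \<in> {1..N} \<and> [n = a] (mod m). mangoldt n / real n) - ln (real N))) \<le> C"
    if "N > 0" for N using C[OF that] by simp
  have tot: "real (totient m) > 0" using m by simp
  have "\<bar>(\<Sum>p | p \<in> {1..N} \<and> prime p \<and> [p = a] (mod m). ln (real p) / real p)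
      - ln (real N) / real (totient m)\<bar> \<le> C / real (totient m) + D" if N: "N > 0" for N
  proof -
    define A where "A = (\<Sum>p | p \<in> {1..N} \<and> prime p \<and> [p = a] (mod m). ln (real p) / real p)"
    define S where "S = (\<Sum>n | n \<in> {1..N} \<and> [n = a] (mod m). mangoldt n / real n :: real)"
    define E where "E = (\<Sum>n | n \<in> {1..N} \<and> \<not> prime n \<and> [n = a] (mod m). mangoldt n / real n :: real)"
    have "A = (\<Sum>p | p \<in> {1..N} \<and> prime p \<and> [p = a] (mod m). mangoldt p / real p)"
      unfolding A_def by (intro sum.cong refl) auto
    moreover have "S = (\<Sum>p | p \<in> {1..N} \<and> prime p \<and> [p = a] (mod m). mangoldt p / real p) + E"
      unfolding S_def E_def by (subst sum.union_disjoint[symmetric]) (auto intro!: sum.cong)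
    ultimately have "S = A + E" by simp
    moreover have "0 \<le> E" unfolding E_def by (intro sum_nonneg) (auto simp: mangoldt_nonneg)
    moreover have "E \<le> (\<Sum>n | n \<in> {1..N} \<and> \<not> prime n. mangoldt n / real n)"
      unfolding E_def by (intro sum_mono2) (auto simp: mangoldt_nonneg)
    moreover have "\<bar>S - ln (real N) / real (totient m)\<bar> \<le> C / real (totient m)"
    proof -
      have "S - ln (real N) / real (totient m) = (real (totient m) * S - ln (real N)) / real (totient m)"
        using tot by (simp add: field_simps)
      moreover have "\<bar>real (totient m) * S - ln (real N)\<bar> \<le> C"
        using C'[OF N] unfolding norm_of_real S_def .
      ultimately show ?thesis using tot by (simp add: divide_right_mono)
    qed
    ultimately show ?thesis using D[of N] unfolding A_def by linarith
  qed
  thus ?thesis by blast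
qed

section \<open>From the sum of ln p / p to the sum of 1 / p\<close>

text \<open>With consecutive logarithms \<open>u \<le> v\<close>, the increment
  \<open>ln v - ln u\<close> lies between \<open>(v - u) / v\<close> and \<open>(v - u) / u\<close>.
  As \<open>v - u \<le> 1\<close>, these bounds differ by at most \<open>1 / u - 1 / v\<close>,
  which telescopes.\<close>

lemma summable_ln_ratio_minus_ln_ln:
  "summable (\<lambda>n. if n \<ge> 3 then (ln (real n) - ln (real (n - 1))) / ln (real n)
      - (ln (ln (real n)) - ln (ln (real (n - 1)))) else 0)" (is "summable ?h")
proof (rule summable_comparison_test')
  have "(\<lambda>n. 1 / ln (real n)) \<longlonglongrightarrow> 0" by real_asymp
  from telescope_summable'[OF this] have "summable (\<lambda>n. 1 / ln (real n) - 1 / ln (real (Suc n)))" .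
  hence "summable (\<lambda>n. 1 / ln (real (Suc n - 1)) - 1 / ln (real (Suc n)))" by simp
  thus "summable (\<lambda>n. 1 / ln (real (n - 1)) - 1 / ln (real n))"
    by (subst (asm) summable_Suc_iff[where f = "\<lambda>n. 1 / ln (real (n - 1)) - 1 / ln (real n)"])
  fix n :: nat assume n: "n \<ge> 3"
  define u v where "u = ln (real (n - 1))" and "v = ln (real n)"
  have u: "u > 0" using n by (simp add: u_def)
  have uv: "u \<le> v" using n by (simp add: u_def v_def)
  have "ln (real n / real (n - 1)) \<le> real n / real (n - 1) - 1"
    using n by (intro ln_le_minus_one) auto
  also have "\<dots> \<le> 1" using n by (simp add: field_simps of_nat_diff)
  finally have d: "v - u \<le> 1" using n by (simp add: ln_div u_def v_def)
  have "ln (u / v) \<le> u / v - 1" using u uv by (intro ln_le_minus_one) auto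
  hence 1: "(v - u) / v \<le> ln v - ln u" using u uv by (simp add: ln_div field_simps)
  have "ln (v / u) \<le> v / u - 1" using u uv by (intro ln_le_minus_one) auto
  hence 2: "ln v - ln u \<le> (v - u) / u" using u uv by (simp add: ln_div field_simps)
  have "(v - u) / u - (v - u) / v = (v - u) * (1 / u - 1 / v)" by (simp add: algebra_simps)
  also have "\<dots> \<le> 1 * (1 / u - 1 / v)" using d u uv by (intro mult_right_mono) (auto simp: frac_le)
  finally have 3: "(v - u) / u - (v - u) / v \<le> 1 / u - 1 / v" by simp
  have "\<bar>x - y\<bar> \<le> w" if "x \<le> y" "y \<le> z" "z - x \<le> w" for x y z w :: real using that by linarith
  from this[OF 1 2 3] have "\<bar>(v - u) / v - (ln v - ln u)\<bar> \<le> 1 / u - 1 / v" .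
  thus "norm (?h n) \<le> 1 / ln (real (n - 1)) - 1 / ln (real n)"
    using n by (simp add: u_def v_def)
qed

text \<open>Mertens' theorem says that \<open>f\<close>, the prime weight minus the mean increment
  of \<open>ln\<close>, has bounded partial sums, so Dirichlet's test applies with the factor
  \<open>1 / ln n\<close>. The summable \<open>h\<close> then trades the increment of
  \<open>ln\<close> divided by \<open>ln n\<close> for the increment of
  \<open>ln (ln n)\<close>.\<close>

theorem sum_inverse_primes_ap_convergent:
  assumes m: "m > 0" and a: "coprime a m"
  shows "convergent (\<lambda>N. (\<Sum>p | p \<in> {1..N} \<and> prime p \<and> [p = a] (mod m). 1 / real p)
            - ln (ln (real N)) / real (totient m))"
proof -
  define t where "t = real (totient m)"
  define w where "w n = (if prime n \<and> [n = a] (mod m) then ln (real n) / real n else 0)" for n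
  \<comment> \<open>Starting at \<open>3\<close> keeps \<open>ln (n - 1)\<close> positive, as
    \<open>ln (ln (n - 1))\<close> demands; the omitted terms only shift the limit.\<close>
  define f where "f n = (if n \<ge> 3 then w n - (ln (real n) - ln (real (n - 1))) / t else 0)" for n
  define h where "h n = (if n \<ge> 3 then (ln (real n) - ln (real (n - 1))) / ln (real n)
      - (ln (ln (real n)) - ln (ln (real (n - 1)))) else 0)" for n :: nat
  obtain C where C: "\<And>N. N > 0 \<Longrightarrow> \<bar>(\<Sum>p | p \<in> {1..N} \<and> prime p \<and> [p = a] (mod m). ln (real p) / real p)
      - ln (real N) / t\<bar> \<le> C"
    using Mertens_primes_ap[OF assms] unfolding t_def by blast
  have sum_w: "(\<Sum>p | p \<in> {1..N} \<and> prime p \<and> [p = a] (mod m). ln (real p) / real p) = (\<Sum>n=1..N. w n)" for N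
    unfolding w_def by (intro sum.mono_neutral_cong_left) auto
  have sum_f: "(\<Sum>n<Suc N. f n) = (\<Sum>n=1..N. w n) - w 1 - w 2 - (ln (real N) - ln 2) / t" if "N \<ge> 2" for N
    using that
  proof (induction N rule: dec_induct)
    case base
    show ?case by (simp add: f_def numeral_2_eq_2)
  next
    case (step N)
    have "(\<Sum>n<Suc (Suc N). f n) = (\<Sum>n<Suc N. f n) + f (Suc N)" by simp
    also have "f (Suc N) = w (Suc N) - (ln (real (Suc N)) - ln (real N)) / t" using step by (simp add: f_def)
    finally show ?case using step.IH by (simp add: diff_divide_distrib)
  qed
  have bd: "norm (\<Sum>n<N. f n) \<le> C + \<bar>w 1 + w 2\<bar> + \<bar>ln 2 / t\<bar>" for N
  proof (cases "N \<ge> 3")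
    case True
    then obtain M where M: "N = Suc M" "M \<ge> 2" by (cases N) auto
    have "\<bar>(\<Sum>n=1..M. w n) - ln (real M) / t\<bar> \<le> C" using C[of M] M unfolding sum_w by simp
    thus ?thesis unfolding M(1) sum_f[OF M(2)] diff_divide_distrib real_norm_def by linarith
  next
    case False
    hence "(\<Sum>n<N. f n) = 0" by (intro sum.neutral) (auto simp: f_def)
    moreover have "C \<ge> 0" using C[of 1] by linarith
    ultimately show ?thesis by simp
  qed
  have "summable (\<lambda>n. (1 / ln (real n)) *\<^sub>R f n)"
  proof (rule Dirichlet_test_summable[OF bd, where a = 2])
    show "(\<lambda>n. 1 / ln (real n)) \<longlonglongrightarrow> 0" by real_asymp
  qed (auto intro!: frac_le)
  moreover have "summable (\<lambda>n. h n / t)"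
    using summable_ln_ratio_minus_ln_ln unfolding h_def by (rule summable_divide)
  ultimately have "summable (\<lambda>n. (1 / ln (real n)) *\<^sub>R f n + h n / t)" by (rule summable_add)
  hence conv: "convergent (\<lambda>N. \<Sum>n<Suc N. (1 / ln (real n)) *\<^sub>R f n + h n / t)"
    unfolding summable_iff_convergent by (subst convergent_Suc_iff)
  define P where "P N = (\<Sum>p | p \<in> {1..N} \<and> prime p \<and> [p = a] (mod m). 1 / real p)" for N
  have P_Suc: "P (Suc N) = P N + w (Suc N) / ln (real (Suc N))" if "N \<ge> 1" for N
  proof -
    have P: "P N = (\<Sum>n=1..N. if prime n \<and> [n = a] (mod m) then 1 / real n else 0)" for N
      unfolding P_def by (intro sum.mono_neutral_cong_left) auto
    show ?thesis using that unfolding P by (simp add: w_def)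
  qed
  have "(\<Sum>n<Suc N. (1 / ln (real n)) *\<^sub>R f n + h n / t) = P N - P 2 - (ln (ln (real N)) - ln (ln 2)) / t"
    if "N \<ge> 2" for N
    using that
  proof (induction N rule: dec_induct)
    case base
    show ?case by (simp add: f_def h_def numeral_2_eq_2)
  next
    case (step N)
    have "(\<Sum>n<Suc (Suc N). (1 / ln (real n)) *\<^sub>R f n + h n / t)
        = (\<Sum>n<Suc N. (1 / ln (real n)) *\<^sub>R f n + h n / t) + ((1 / ln (real (Suc N))) * f (Suc N) + h (Suc N) / t)"
      by simp
    also have "(1 / ln (real (Suc N))) * f (Suc N) + h (Suc N) / t
        = w (Suc N) / ln (real (Suc N)) - (ln (ln (real (Suc N))) - ln (ln (real N))) / t"
    proof -
      have "1 / l * (x - d / t) + (d / l - e) / t = x / l - e / t" for l x d e :: real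
        by (simp add: diff_divide_distrib right_diff_distrib mult.commute)
      thus ?thesis using step by (simp add: f_def h_def)
    qed
    finally show ?case using step P_Suc[of N] by (simp add: diff_divide_distrib)
  qed
  hence "eventually (\<lambda>N. (\<Sum>n<Suc N. (1 / ln (real n)) *\<^sub>R f n + h n / t) + (P 2 - ln (ln 2) / t)
      = P N - ln (ln (real N)) / t) sequentially"
    by (intro eventually_sequentiallyI[of 2]) (simp add: diff_divide_distrib)
  moreover have "convergent (\<lambda>N. (\<Sum>n<Suc N. (1 / ln (real n)) *\<^sub>R f n + h n / t) + (P 2 - ln (ln 2) / t))"
    by (intro convergent_add conv convergent_const)
  ultimately show ?thesis unfolding P_def t_def convergent_def
    by (blast intro: Lim_transform_eventually)
qed

section \<open>The integral\<close>

text \<open>The function \<open>S\<close> of the overview.\<close>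

definition inverse_prime_sum_ap :: "real \<Rightarrow> nat \<Rightarrow> nat \<Rightarrow> real" where
  "inverse_prime_sum_ap x m n = (\<Sum>p | prime p \<and> real p \<le> x \<and> [p = n] (mod m). 1 / real p)"

lemma finite_primes_ap_le [simp]: "finite {p::nat. prime p \<and> real p \<le> x \<and> [p = n] (mod m)}"
proof (rule finite_subset)
  show "{p::nat. prime p \<and> real p \<le> x \<and> [p = n] (mod m)} \<subseteq> {..nat \<lfloor>x\<rfloor>}"
    by (auto simp: le_nat_floor)
qed auto

text \<open>The limit along integers passes to real \<open>x\<close>, since rounding
  \<open>x\<close> down changes \<open>ln (ln x)\<close> by a quantity that tends to
  \<open>0\<close>.\<close>

lemma inverse_prime_sum_ap_asymp:
  assumes m: "m > 0" and n: "coprime n m"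
  obtains c where
    "((\<lambda>x. inverse_prime_sum_ap x m n - ln (ln x) / real (totient m)) \<longlongrightarrow> c) at_top"
proof -
  define t where "t = real (totient m)"
  define P where "P N = (\<Sum>p | p \<in> {1..N} \<and> prime p \<and> [p = n] (mod m). 1 / real p)" for N
  obtain c where c: "(\<lambda>N. P N - ln (ln (real N)) / t) \<longlonglongrightarrow> c"
    using sum_inverse_primes_ap_convergent[OF assms] unfolding convergent_def P_def t_def by blast
  have P: "inverse_prime_sum_ap x m n = P (nat \<lfloor>x\<rfloor>)" if "x \<ge> 1" for x
    unfolding inverse_prime_sum_ap_def P_def using that
    by (intro sum.cong) (auto simp: le_nat_iff le_floor_iff prime_ge_Suc_0_nat le_nat_floor)
  have floor: "filterlim (\<lambda>x::real. nat \<lfloor>x\<rfloor>) sequentially at_top"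
    using filterlim_compose[OF filterlim_nat_sequentially filterlim_floor_sequentially] .
  have lim: "((\<lambda>x::real. P (nat \<lfloor>x\<rfloor>) - ln (ln (real (nat \<lfloor>x\<rfloor>))) / t) \<longlongrightarrow> c) at_top"
    using filterlim_compose[OF c floor] .
  have "((\<lambda>x. ln (ln (real (nat \<lfloor>x\<rfloor>))) - ln (ln x)) \<longlongrightarrow> 0) at_top"
  proof (rule tendsto_sandwich)
    show "((\<lambda>x::real. ln (ln (x - 1)) - ln (ln x)) \<longlongrightarrow> 0) at_top" by real_asymp
    show "eventually (\<lambda>x. ln (ln (x - 1)) - ln (ln x) \<le> ln (ln (real (nat \<lfloor>x\<rfloor>))) - ln (ln x)) at_top"
      using eventually_ge_at_top[of 3]
    proof eventually_elim
      case (elim x)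
      have "x - 1 \<le> real (nat \<lfloor>x\<rfloor>)" by linarith
      moreover from this have "ln (x - 1) \<le> ln (real (nat \<lfloor>x\<rfloor>))" using elim by simp
      moreover have "ln (x - 1) > 0" using elim by simp
      ultimately show ?case by simp
    qed
    show "eventually (\<lambda>x. ln (ln (real (nat \<lfloor>x\<rfloor>))) - ln (ln x) \<le> 0) at_top"
      using eventually_ge_at_top[of 3]
    proof eventually_elim
      case (elim x)
      have "real (nat \<lfloor>x\<rfloor>) \<le> x" "2 \<le> real (nat \<lfloor>x\<rfloor>)" using elim by linarith+
      moreover from this have "ln (real (nat \<lfloor>x\<rfloor>)) \<le> ln x" "ln (real (nat \<lfloor>x\<rfloor>)) > 0" by simp_all
      ultimately show ?case by simp
    qed
  qed auto
  from tendsto_add[OF lim tendsto_divide[OF this tendsto_const[of t]]]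
  have "((\<lambda>x. P (nat \<lfloor>x\<rfloor>) - ln (ln x) / t) \<longlongrightarrow> c) at_top"
    using m by (simp add: diff_divide_distrib t_def)
  hence "((\<lambda>x. inverse_prime_sum_ap x m n - ln (ln x) / t) \<longlongrightarrow> c) at_top"
    by (rule Lim_transform_eventually) (rule eventually_at_top_linorderI[of 1], simp add: P)
  thus ?thesis using that unfolding t_def by blast
qed

lemma inverse_prime_sum_ap_powr_diff:
  assumes m: "m > 0" and n: "coprime n m" and a: "a > 0"
  shows "((\<lambda>x. inverse_prime_sum_ap (x powr a) m n - inverse_prime_sum_ap x m n)
            \<longlongrightarrow> ln a / real (totient m)) at_top"
proof -
  obtain c where c: "((\<lambda>x. inverse_prime_sum_ap x m n - ln (ln x) / real (totient m)) \<longlongrightarrow> c) at_top"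
    using inverse_prime_sum_ap_asymp[OF m n] by blast
  have "filterlim (\<lambda>x::real. x powr a) at_top at_top" using a by real_asymp
  from tendsto_diff[OF filterlim_compose[OF c this] c]
  have "((\<lambda>x. (inverse_prime_sum_ap (x powr a) m n - ln (ln (x powr a)) / real (totient m))
      - (inverse_prime_sum_ap x m n - ln (ln x) / real (totient m)) + ln a / real (totient m))
      \<longlongrightarrow> c - c + ln a / real (totient m)) at_top"
    by (intro tendsto_add tendsto_const)
  moreover have "eventually (\<lambda>x. (inverse_prime_sum_ap (x powr a) m n - ln (ln (x powr a)) / real (totient m))
      - (inverse_prime_sum_ap x m n - ln (ln x) / real (totient m)) + ln a / real (totient m)
      = inverse_prime_sum_ap (x powr a) m n - inverse_prime_sum_ap x m n) at_top"
    using eventually_gt_at_top[of 1]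
  proof eventually_elim
    case (elim x)
    hence "ln (ln (x powr a)) = ln a + ln (ln x)" using a by (simp add: ln_powr ln_mult)
    thus ?case by (simp add: add_divide_distrib)
  qed
  ultimately have "((\<lambda>x. inverse_prime_sum_ap (x powr a) m n - inverse_prime_sum_ap x m n)
      \<longlongrightarrow> c - c + ln a / real (totient m)) at_top"
    by (rule Lim_transform_eventually)
  thus ?thesis by simp
qed

text \<open>A constant factor changes \<open>ln (ln x)\<close> only by a term tending to
  \<open>0\<close>. This is how the sparsity of the primes between \<open>e * x\<close> and
  \<open>x\<close> enters.\<close>

lemma inverse_prime_sum_ap_scale_diff:
  assumes m: "m > 0" and n: "coprime n m" and e: "e > 0"
  shows "((\<lambda>x. inverse_prime_sum_ap x m n - inverse_prime_sum_ap (e * x) m n) \<longlongrightarrow> 0) at_top"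
proof -
  obtain c where c: "((\<lambda>x. inverse_prime_sum_ap x m n - ln (ln x) / real (totient m)) \<longlongrightarrow> c) at_top"
    using inverse_prime_sum_ap_asymp[OF m n] by blast
  have "filterlim (\<lambda>x::real. e * x) at_top at_top" using e by real_asymp
  note d = tendsto_diff[OF c filterlim_compose[OF c this]]
  have "((\<lambda>x. ln (ln x) - ln (ln (e * x))) \<longlongrightarrow> 0) at_top" using e by real_asymp
  from tendsto_add[OF d tendsto_divide[OF this tendsto_const[of "real (totient m)"]]]
  show ?thesis using m by (simp add: diff_divide_distrib)
qed

text \<open>For \<open>k \<ge> 0\<close> every term is at most the last one; for negative
  \<open>k\<close> the sum is compared with the integral. The maximum covers both constants.\<close>

lemma sum_powr_le:
  fixes k :: real
  assumes k: "k > -1"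
  shows "(\<Sum>j=1..N. real j powr k) \<le> max 1 (1 / (k + 1)) * real N powr (k + 1)"
proof (cases "N = 0")
  case False
  hence N: "N > 0" by simp
  show ?thesis
  proof (cases "k \<ge> 0")
    case True
    have "(\<Sum>j=1..N. real j powr k) \<le> (\<Sum>j=1..N. real N powr k)"
      using True by (intro sum_mono powr_mono2) auto
    also have "\<dots> = 1 * real N powr (k + 1)" using N by (simp add: powr_add mult.commute)
    also have "\<dots> \<le> max 1 (1 / (k + 1)) * real N powr (k + 1)" by (intro mult_right_mono) auto
    finally show ?thesis .
  next
    case k0: False
    \<comment> \<open>The mean value theorem applied to \<open>z powr (k + 1)\<close>, whose
      derivative decreases for negative \<open>k\<close>.\<close>
    have step: "(k + 1) * real (Suc j) powr k \<le> real (Suc j) powr (k + 1) - real j powr (k + 1)" for j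
    proof (cases "j = 0")
      case False
      have "\<exists>z>real j. z < real (Suc j) \<and> real (Suc j) powr (k + 1) - real j powr (k + 1)
          = (real (Suc j) - real j) * ((k + 1) * z powr k)"
        by (rule MVT2) (use False k in \<open>auto intro!: derivative_eq_intros simp: powr_diff\<close>)
      then obtain z where z: "real j < z" "z < real (Suc j)"
        "real (Suc j) powr (k + 1) - real j powr (k + 1) = (k + 1) * z powr k" by auto
      have "real (Suc j) powr k \<le> z powr k" using z False k0 by (intro powr_mono2') auto
      thus ?thesis using z(3) k by simp
    qed (use k k0 in simp)
    have "(k + 1) * (\<Sum>j=1..N. real j powr k) = (\<Sum>j<N. (k + 1) * real (Suc j) powr k)"
      by (simp add: sum_distrib_left sum.atLeast1_atMost_eq)
    also have "\<dots> \<le> (\<Sum>j<N. real (Suc j) powr (k + 1) - real j powr (k + 1))"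
      by (intro sum_mono step)
    also have "\<dots> = real N powr (k + 1)"
      using sum_lessThan_telescope[of "\<lambda>j. real j powr (k + 1)" N] by simp
    finally have "(\<Sum>j=1..N. real j powr k) \<le> 1 / (k + 1) * real N powr (k + 1)"
      using k by (simp add: field_simps)
    also have "\<dots> \<le> max 1 (1 / (k + 1)) * real N powr (k + 1)" by (intro mult_right_mono) auto
    finally show ?thesis .
  qed
qed auto

lemma prime_power_sum_ap_tendsto_0:
  assumes m: "m > 0" and n: "coprime n m" and k: "k > -1"
  shows "((\<lambda>x. prime_power_sum_ap k x m n / x powr (k + 1)) \<longlongrightarrow> 0) at_top"
proof (rule tendstoI)
  fix \<epsilon> :: real assume \<epsilon>: "\<epsilon> > 0"
  define D where "D = max 1 (1 / (k + 1))"
  have D: "D \<ge> 1" by (simp add: D_def)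
  have "((\<lambda>e. D * e powr (k + 1)) \<longlongrightarrow> 0) (at_right 0)"
  proof -
    have "k + 1 > 0" using k by simp
    thus ?thesis by real_asymp
  qed
  hence "eventually (\<lambda>e. D * e powr (k + 1) < \<epsilon> / 2) (at_right 0)"
    using \<epsilon> by (intro order_tendstoD(2)[of _ 0]) auto
  hence "eventually (\<lambda>e. D * e powr (k + 1) < \<epsilon> / 2 \<and> e > 0 \<and> e < 1) (at_right 0)"
    by (intro eventually_conj) (auto simp: eventually_at_right_less eventually_at_right_field intro: exI[of _ 1])
  then obtain e where e: "D * e powr (k + 1) < \<epsilon> / 2" "0 < e" "e < 1"
    using eventually_happens[of _ "at_right (0::real)"] by (auto simp: trivial_limit_at_right_real)
  have "eventually (\<lambda>x. inverse_prime_sum_ap x m n - inverse_prime_sum_ap (e * x) m n < \<epsilon> / 2) at_top"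
    using \<epsilon> by (intro order_tendstoD(2)[OF inverse_prime_sum_ap_scale_diff[OF m n e(2)]]) simp
  thus "eventually (\<lambda>x. dist (prime_power_sum_ap k x m n / x powr (k + 1)) 0 < \<epsilon>) at_top"
    using eventually_ge_at_top[of 1]
  proof eventually_elim
    case (elim x)
    let ?A = "\<lambda>y. {p::nat. prime p \<and> real p \<le> y \<and> [p = n] (mod m)}"
    have ex: "e * x \<le> x" "e * x > 0" using e elim by (simp_all add: mult_left_le_one_le)
    have sub: "?A (e * x) \<subseteq> ?A x" using ex by auto
    have "prime_power_sum_ap k x m n = (\<Sum>p\<in>?A (e * x). real p powr k) + (\<Sum>p\<in>?A x - ?A (e * x). real p powr k)"
      unfolding prime_power_sum_ap_def using sum.subset_diff[OF sub, of "\<lambda>p. real p powr k"] by simp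
    also have "(\<Sum>p\<in>?A (e * x). real p powr k) \<le> (\<Sum>j=1..nat \<lfloor>e * x\<rfloor>. real j powr k)"
      by (intro sum_mono2) (auto simp: le_nat_floor prime_ge_Suc_0_nat)
    also have "\<dots> \<le> D * real (nat \<lfloor>e * x\<rfloor>) powr (k + 1)" unfolding D_def by (rule sum_powr_le[OF k])
    also have "\<dots> \<le> D * (e * x) powr (k + 1)"
    proof -
      have "real (nat \<lfloor>e * x\<rfloor>) \<le> e * x" using ex by linarith
      thus ?thesis using D k by (intro mult_left_mono powr_mono2) auto
    qed
    also have "\<dots> = D * e powr (k + 1) * x powr (k + 1)" using e elim by (simp add: powr_mult)
    also have "(\<Sum>p\<in>?A x - ?A (e * x). real p powr k) \<le> (\<Sum>p\<in>?A x - ?A (e * x). x powr (k + 1) * (1 / real p))"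
    proof (rule sum_mono)
      fix p assume p: "p \<in> ?A x - ?A (e * x)"
      hence p0: "real p > 0" by (auto simp: prime_gt_0_nat)
      have "real p powr k = real p powr (k + 1) * (1 / real p)" using p0 by (simp add: powr_add)
      also have "\<dots> \<le> x powr (k + 1) * (1 / real p)"
        using p p0 k by (intro mult_right_mono powr_mono2) auto
      finally show "real p powr k \<le> x powr (k + 1) * (1 / real p)" .
    qed
    also have "\<dots> = x powr (k + 1) * (inverse_prime_sum_ap x m n - inverse_prime_sum_ap (e * x) m n)"
      unfolding inverse_prime_sum_ap_def sum_distrib_left[symmetric]
      using sum.subset_diff[OF sub, of "\<lambda>p. 1 / real p"] by simp
    finally have "prime_power_sum_ap k x m n \<le> x powr (k + 1) *
        (D * e powr (k + 1) + (inverse_prime_sum_ap x m n - inverse_prime_sum_ap (e * x) m n))"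
      by (simp add: algebra_simps)
    also have "\<dots> < x powr (k + 1) * \<epsilon>"
      using elim e by (intro mult_strict_left_mono) auto
    finally have "prime_power_sum_ap k x m n / x powr (k + 1) < \<epsilon>"
      using elim by (simp add: field_simps)
    moreover have "prime_power_sum_ap k x m n \<ge> 0"
      unfolding prime_power_sum_ap_def by (intro sum_nonneg) auto
    ultimately show ?case by simp
  qed
qed

text \<open>The contribution of a single prime, which enters the integrand at \<open>t = c\<close>:
  \<open>c\<close> is \<open>p\<close> for the power sum and \<open>p powr (1 / (k + 1))\<close> for
  the count.\<close>

lemma step_powr_has_integral:
  fixes k c x :: real
  assumes k: "k > -1" and c: "1 \<le> c" "c \<le> x"
  shows "((\<lambda>t. if c \<le> t then t powr (-(k + 2)) else 0) has_integral
            (c powr (-(k + 1)) - x powr (-(k + 1))) / (k + 1)) {1..x}"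
proof -
  have "((\<lambda>t. t powr (-(k + 2))) has_integral
      (- (x powr (-(k + 1)) / (k + 1)) - (- (c powr (-(k + 1)) / (k + 1))))) {c..x}"
  proof (rule fundamental_theorem_of_calculus[OF c(2)])
    fix t assume t: "t \<in> {c..x}"
    have "((\<lambda>t. - (t powr (-(k + 1)) / (k + 1))) has_real_derivative
        - (-(k + 1) * t powr (-(k + 1) - 1) / (k + 1))) (at t within {c..x})"
      using t c by (intro DERIV_minus DERIV_cdivide DERIV_subset[OF has_real_derivative_powr]) auto
    moreover have "-(k + 1) - 1 = -(k + 2)" by simp
    hence "- (-(k + 1) * t powr (-(k + 1) - 1) / (k + 1)) = t powr (-(k + 2))"
      using k by (simp only:) (simp add: field_simps)
    ultimately have "((\<lambda>t. - (t powr (-(k + 1)) / (k + 1))) has_real_derivative t powr (-(k + 2))) (at t within {c..x})"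
      by (simp only:)
    thus "((\<lambda>t. - (t powr (-(k + 1)) / (k + 1))) has_vector_derivative t powr (-(k + 2))) (at t within {c..x})"
      by (simp add: has_real_derivative_iff_has_vector_derivative)
  qed
  hence "((\<lambda>t. if t \<in> {c..x} then t powr (-(k + 2)) else 0) has_integral
      (c powr (-(k + 1)) - x powr (-(k + 1))) / (k + 1)) {1..x}"
    using c by (subst has_integral_restrict) (auto simp: diff_divide_distrib)
  thus ?thesis by (rule has_integral_eq[rotated]) auto
qed

theorem theorem2:
  fixes k :: real and m n :: nat
  assumes "k > -1" and "m > 0" and "n > 0" and "coprime m n"
  defines "f \<equiv> (\<lambda>t::real. (prime_power_sum_ap k t m n - prime_count_ap (t powr (k + 1)) m n)
                              / t powr (k + 2))"
  shows "(\<forall>x\<ge>1. f integrable_on {1..x}) \<and>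
         ((\<lambda>x. integral {1..x} f) \<longlongrightarrow> - ln (k + 1) / ((k + 1) * real (totient m))) at_top"
proof -
  have k: "k > -1" and k1: "k + 1 > 0" using assms by simp_all
  have cop: "coprime n m" using assms by (simp add: coprime_commute)
  \<comment> \<open>The result of termwise integration up to \<open>x\<close>: a difference of two
    values of \<open>S\<close>, each accompanied by its boundary term.\<close>
  define I where "I x = ((inverse_prime_sum_ap x m n - prime_power_sum_ap k x m n / x powr (k + 1))
      - (inverse_prime_sum_ap (x powr (k + 1)) m n - prime_count_ap (x powr (k + 1)) m n / x powr (k + 1))) / (k + 1)"
    for x
  have int: "(f has_integral I x) {1..x}" if x: "x \<ge> 1" for x
  proof -
    \<comment> \<open>Index sets fixed at the upper limit \<open>x\<close>; the dependence on
      \<open>t\<close> moves into the step functions, which makes the sums finite with constant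
      range.\<close>
    define A where "A = {p::nat. prime p \<and> real p \<le> x \<and> [p = n] (mod m)}"
    define B where "B = {p::nat. prime p \<and> real p \<le> x powr (k + 1) \<and> [p = n] (mod m)}"
    have fin: "finite A" "finite B" by (simp_all add: A_def B_def)
    have pos: "real p \<ge> 1" if "p \<in> A \<union> B" for p
      using that by (auto simp: A_def B_def prime_ge_Suc_0_nat Suc_le_eq prime_gt_0_nat)
    have root_le: "real p powr (1 / (k + 1)) \<le> t \<longleftrightarrow> real p \<le> t powr (k + 1)" if "t \<ge> 1" for p :: nat and t
    proof
      assume "real p powr (1 / (k + 1)) \<le> t"
      hence "(real p powr (1 / (k + 1))) powr (k + 1) \<le> t powr (k + 1)" using k1 by (intro powr_mono2) auto
      thus "real p \<le> t powr (k + 1)" using k1 by (simp add: powr_powr)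
    next
      assume "real p \<le> t powr (k + 1)"
      hence "real p powr (1 / (k + 1)) \<le> (t powr (k + 1)) powr (1 / (k + 1))" using k1 by (intro powr_mono2) auto
      thus "real p powr (1 / (k + 1)) \<le> t" using k1 that by (simp add: powr_powr)
    qed
    have 1: "((\<lambda>t. \<Sum>p\<in>A. real p powr k * (if real p \<le> t then t powr (-(k + 2)) else 0)) has_integral
        (\<Sum>p\<in>A. real p powr k * ((real p powr (-(k + 1)) - x powr (-(k + 1))) / (k + 1)))) {1..x}"
      using pos by (intro has_integral_sum fin has_integral_mult_right step_powr_has_integral k) (auto simp: A_def)
    have 2: "((\<lambda>t. \<Sum>p\<in>B. if real p powr (1 / (k + 1)) \<le> t then t powr (-(k + 2)) else 0) has_integral
        (\<Sum>p\<in>B. ((real p powr (1 / (k + 1))) powr (-(k + 1)) - x powr (-(k + 1))) / (k + 1))) {1..x}"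
      using pos k1 x by (intro has_integral_sum fin step_powr_has_integral k) (auto simp: B_def root_le ge_one_powr_ge_zero)
    have "(\<Sum>p\<in>A. real p powr k * ((real p powr (-(k + 1)) - x powr (-(k + 1))) / (k + 1)))
        = (\<Sum>p\<in>A. (1 / real p - real p powr k / x powr (k + 1)) / (k + 1))"
    proof (intro sum.cong refl)
      fix p assume "p \<in> A"
      hence p: "real p > 0" using pos[of p] by auto
      have "real p powr k * real p powr (-(k + 1)) = real p powr (-1)" by (simp flip: powr_add)
      also have "\<dots> = 1 / real p" using p by (simp add: powr_minus_divide)
      finally have *: "real p powr k * real p powr (-(k + 1)) = 1 / real p" .
      show "real p powr k * ((real p powr (-(k + 1)) - x powr (-(k + 1))) / (k + 1))
          = (1 / real p - real p powr k / x powr (k + 1)) / (k + 1)"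
        unfolding times_divide_eq_right right_diff_distrib * powr_minus_divide[of x "k + 1"] mult_1_right ..
    qed
    also have "\<dots> = (inverse_prime_sum_ap x m n - prime_power_sum_ap k x m n / x powr (k + 1)) / (k + 1)"
      by (simp add: A_def inverse_prime_sum_ap_def prime_power_sum_ap_def sum_subtractf
        flip: sum_divide_distrib)
    finally have v1: "(\<Sum>p\<in>A. real p powr k * ((real p powr (-(k + 1)) - x powr (-(k + 1))) / (k + 1))) = \<dots>" .
    have "(\<Sum>p\<in>B. ((real p powr (1 / (k + 1))) powr (-(k + 1)) - x powr (-(k + 1))) / (k + 1))
        = (\<Sum>p\<in>B. (1 / real p - 1 / x powr (k + 1)) / (k + 1))"
    proof (intro sum.cong refl)
      fix p assume "p \<in> B"
      hence p: "real p > 0" using pos[of p] by auto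
      have "1 / (k + 1) * (-(k + 1)) = -1" using k1 by (simp add: field_simps)
      hence "(real p powr (1 / (k + 1))) powr (-(k + 1)) = real p powr (-1)" by (simp only: powr_powr)
      also have "\<dots> = 1 / real p" using p by (simp add: powr_minus_divide)
      finally show "((real p powr (1 / (k + 1))) powr (-(k + 1)) - x powr (-(k + 1))) / (k + 1)
          = (1 / real p - 1 / x powr (k + 1)) / (k + 1)"
        unfolding powr_minus_divide[of x "k + 1"] by (simp only:)
    qed
    also have "\<dots> = (inverse_prime_sum_ap (x powr (k + 1)) m n
        - prime_count_ap (x powr (k + 1)) m n / x powr (k + 1)) / (k + 1)"
      by (simp add: B_def inverse_prime_sum_ap_def prime_count_ap_def sum_subtractf
        flip: sum_divide_distrib)
    finally have v2: "(\<Sum>p\<in>B. ((real p powr (1 / (k + 1))) powr (-(k + 1)) - x powr (-(k + 1))) / (k + 1)) = \<dots>" .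
    have "((\<lambda>t. (\<Sum>p\<in>A. real p powr k * (if real p \<le> t then t powr (-(k + 2)) else 0))
        - (\<Sum>p\<in>B. if real p powr (1 / (k + 1)) \<le> t then t powr (-(k + 2)) else 0)) has_integral I x) {1..x}"
      using has_integral_diff[OF 1 2] unfolding v1 v2 I_def diff_divide_distrib[symmetric] .
    moreover have "(\<Sum>p\<in>A. real p powr k * (if real p \<le> t then t powr (-(k + 2)) else 0))
        - (\<Sum>p\<in>B. if real p powr (1 / (k + 1)) \<le> t then t powr (-(k + 2)) else 0) = f t"
      if t: "t \<in> {1..x}" for t
    proof -
      \<comment> \<open>Ensures that \<open>B\<close> contains every prime counted at
        \<open>t\<close>.\<close>
      have "t powr (k + 1) \<le> x powr (k + 1)" using t k1 by (intro powr_mono2) auto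
      hence B: "(\<Sum>p\<in>B. if real p powr (1 / (k + 1)) \<le> t then t powr (-(k + 2)) else 0)
          = prime_count_ap (t powr (k + 1)) m n * t powr (-(k + 2))"
        unfolding prime_count_ap_def sum_constant[symmetric] using t
        by (subst sum.inter_filter[symmetric, OF fin(2)])
          (auto simp: root_le B_def intro!: arg_cong[of _ _ card])
      have "(\<Sum>p\<in>A. real p powr k * (if real p \<le> t then t powr (-(k + 2)) else 0))
          = (\<Sum>p\<in>A. if real p \<le> t then real p powr k * t powr (-(k + 2)) else 0)"
        by (intro sum.cong) auto
      also have "\<dots> = prime_power_sum_ap k t m n * t powr (-(k + 2))"
        unfolding prime_power_sum_ap_def sum_distrib_right using t
        by (subst sum.inter_filter[symmetric, OF fin(1)]) (auto simp: A_def intro!: sum.cong)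
      finally have A: "(\<Sum>p\<in>A. real p powr k * (if real p \<le> t then t powr (-(k + 2)) else 0))
          = prime_power_sum_ap k t m n * t powr (-(k + 2))" .
      show ?thesis
        unfolding A B f_def diff_divide_distrib by (simp only: powr_minus_divide times_divide_eq_right mult_1_right)
    qed
    ultimately show ?thesis by (rule has_integral_eq[rotated])
  qed
  \<comment> \<open>The count is the case of exponent \<open>0\<close>, so the same density lemma,
    taken at \<open>x powr (k + 1)\<close>, disposes of its boundary term.\<close>
  have count: "prime_count_ap y m n = prime_power_sum_ap 0 y m n" for y
  proof -
    have "prime_power_sum_ap 0 y m n = (\<Sum>p\<in>{p::nat. prime p \<and> real p \<le> y \<and> [p = n] (mod m)}. 1)"
      unfolding prime_power_sum_ap_def by (intro sum.cong) (auto dest: prime_gt_0_nat)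
    thus ?thesis by (simp add: prime_count_ap_def)
  qed
  have "filterlim (\<lambda>x::real. x powr (k + 1)) at_top at_top" using k1 by real_asymp
  from filterlim_compose[OF prime_power_sum_ap_tendsto_0[OF assms(2) cop, of 0] this]
  have "((\<lambda>x. prime_count_ap (x powr (k + 1)) m n / x powr (k + 1)) \<longlongrightarrow> 0) at_top"
    by (simp add: count)
  note lims = prime_power_sum_ap_tendsto_0[OF assms(2) cop k] this
    inverse_prime_sum_ap_powr_diff[OF assms(2) cop k1]
  have "((\<lambda>x. (- (inverse_prime_sum_ap (x powr (k + 1)) m n - inverse_prime_sum_ap x m n)
      - prime_power_sum_ap k x m n / x powr (k + 1)
      + prime_count_ap (x powr (k + 1)) m n / x powr (k + 1)) / (k + 1))
      \<longlongrightarrow> (- (ln (k + 1) / real (totient m)) - 0 + 0) / (k + 1)) at_top"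
    using k1 by (intro tendsto_intros lims) auto
  hence "(I \<longlongrightarrow> - ln (k + 1) / ((k + 1) * real (totient m))) at_top"
    by (simp add: I_def[abs_def] algebra_simps)
  moreover have "eventually (\<lambda>x. I x = integral {1..x} f) at_top"
    using eventually_ge_at_top[of 1] by eventually_elim (simp add: integral_unique[OF int])
  ultimately have "((\<lambda>x. integral {1..x} f) \<longlongrightarrow> - ln (k + 1) / ((k + 1) * real (totient m))) at_top"
    by (rule Lim_transform_eventually)
  thus ?thesis using int by blast
qed

end
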